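(* Let $\Sigma$ be a finite monoid, $l\ge1$ and $d\ge1$. Generic $l$-parameter bifurcations in the fundamental network of $\Sigma$ with $1$-dimensional internal dynamics are also generic in the same network with $d$-dimensional internal dynamics. That is, every $\Sigma$-representation that occurs, up to isomorphism, as the generalized kernel (respectively center subspace) in a generic $l$-parameter bifurcation on $\bigoplus_{\sigma\in\Sigma}\mathbb R$ also occurs, up to isomorphism, as the generalized kernel (respectively center subspace) in a generic $l$-parameter bifurcation on $\bigoplus_{\sigma\in\Sigma}\mathbb R^d$, with equivalent reduced bifurcation problems.
   Context: Fundamental network: let $\Sigma=\{\sigma_1=\mathrm{Id},\dots,\sigma_n\}$ be a finite monoid and $V$ a finite-dimensional real vector space (internal phase space). $\Sigma$ acts on $\bigoplus_{\sigma\in\Sigma}V$ by $(A_\sigma v)_\tau=v_{\tau\sigma}$. Admissible $l$-parameter families are $\Gamma_f(v,\lambda)$, $\lambda\in\mathbb R^l$, with $(\Gamma_f(v,\lambda))_\sigma=f(v_{\sigma_1\sigma},\dots,v_{\sigma_n\sigma},\lambda)$, $f$ smooth; equivalently (known), the smooth families equivariant under all $A_\sigma$. One assumes $\Gamma_f(0,0)=0$. The generalized kernel (steady state bifurcations) is the generalized eigenspace of $D_v\Gamma_f(0,0)$ for eigenvalue $0$; the center subspace is the sum of the generalized eigenspaces for eigenvalues on the imaginary axis. Both are complementable subrepresentations. Types: an indecomposable representation $U$ is of real, complex or quaternionic type according to whether $\mathrm{End}_\Sigma(U)$ modulo its radical is $\mathbb R$, $\mathbb C$ or $\mathbb H$.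 Write, uniquely up to isomorphism, $\bigoplus_\sigma V\cong\bigoplus_i (W_i^{R})^{s_i^R}\oplus\bigoplus_i (W_i^{C})^{s_i^C}\oplus\bigoplus_i (W_i^{H})^{s_i^H}$ with pairwise non-isomorphic indecomposables $W_i^R,W_i^C,W_i^H$ of real, complex, quaternionic type. Genericity (known classification, used as the meaning of "generic"): let $U\cong\bigoplus_i (W_i^{R})^{\rho_i}\oplus\bigoplus_i (W_i^{C})^{\gamma_i}\oplus\bigoplus_i (W_i^{H})^{\iota_i}$ with $0\le\rho_i\le s_i^R$, $0\le\gamma_i\le s_i^C$, $0\le\iota_i\le s_i^H$. In generic $l$-parameter bifurcations, $U$ occurs as a generalized kernel subject to the condition $K_U=\sum\rho_i+2\sum\gamma_i+4\sum\iota_i\le l$, and as a center subspace subject to the condition $C_U=\sum\lceil\rho_i/2\rceil+\sum\gamma_i+\sum\iota_i\le l$. Reduced problem: equivariant Lyapunov–Schmidt or center manifold reduction yields a generic $\Sigma$-equivariant family $r:U\times\mathbb R^l\to U$ on the generalized kernel or center subspace $U$, with $r(0,0)=0$ and linearization in $U$ at $(0,0)$ having only the eigenvalue $0$ (respectively only eigenvalues on the imaginary axis). Two reduced bifurcation problems are equivalent if posed on equivariantly isomorphic representations, so that conjugation by the isomorphism identifies the two classes of equivariant bifurcation problems. *)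

theory Defs
  imports
    "HOL-Analysis.Analysis"
    "HOL-Algebra.QuotRing"
begin

section \<open>Representations of a monoid on subspaces\<close>

text \<open>
  A representation is given by a real subspace \<open>U\<close> of an ambient vector space together with an
  action \<open>a\<close>, of which only the restriction to \<open>U\<close> matters.  The monoid is a type of class
  \<open>monoid_mult\<close>, so its identity is \<open>1\<close>.
\<close>

definition linear_map :: "'a::real_vector set \<Rightarrow> 'b::real_vector set \<Rightarrow> ('a \<Rightarrow> 'b) \<Rightarrow> bool" where
  "linear_map U U' f \<longleftrightarrow>
     f \<in> U \<rightarrow> U' \<and>
     (\<forall>x\<in>U. \<forall>y\<in>U. f (x + y) = f x + f y) \<and>
     (\<forall>c. \<forall>x\<in>U. f (c *\<^sub>R x) = c *\<^sub>R f x)"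

definition representation :: "('s::monoid_mult \<Rightarrow> 'a::real_vector \<Rightarrow> 'a) \<Rightarrow> 'a set \<Rightarrow> bool" where
  "representation a U \<longleftrightarrow>
     subspace U \<and>
     (\<forall>\<sigma>. linear_map U U (a \<sigma>)) \<and>
     (\<forall>x\<in>U. a 1 x = x) \<and>
     (\<forall>\<sigma> \<tau>. \<forall>x\<in>U. a (\<sigma> * \<tau>) x = a \<sigma> (a \<tau> x))"

definition subrep :: "('s \<Rightarrow> 'a::real_vector \<Rightarrow> 'a) \<Rightarrow> 'a set \<Rightarrow> 'a set \<Rightarrow> bool" where
  "subrep a Y X \<longleftrightarrow> subspace Y \<and> Y \<subseteq> X \<and> (\<forall>\<sigma>. \<forall>y\<in>Y. a \<sigma> y \<in> Y)"

definition equivariant ::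
  "('s \<Rightarrow> 'a \<Rightarrow> 'a) \<Rightarrow> 'a set \<Rightarrow> ('s \<Rightarrow> 'b \<Rightarrow> 'b) \<Rightarrow> ('a \<Rightarrow> 'b) \<Rightarrow> bool" where
  "equivariant a U b f \<longleftrightarrow> (\<forall>\<sigma>. \<forall>x\<in>U. f (a \<sigma> x) = b \<sigma> (f x))"

definition rep_isomorphism ::
  "('s \<Rightarrow> 'a::real_vector \<Rightarrow> 'a) \<Rightarrow> 'a set \<Rightarrow> ('s \<Rightarrow> 'b::real_vector \<Rightarrow> 'b) \<Rightarrow> 'b set \<Rightarrow> ('a \<Rightarrow> 'b) \<Rightarrow> bool" where
  "rep_isomorphism a U b U' \<phi> \<longleftrightarrow>
     linear_map U U' \<phi> \<and> equivariant a U b \<phi> \<and> bij_betw \<phi> U U'"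

definition isomorphic_reps ::
  "('s \<Rightarrow> 'a::real_vector \<Rightarrow> 'a) \<Rightarrow> 'a set \<Rightarrow> ('s \<Rightarrow> 'b::real_vector \<Rightarrow> 'b) \<Rightarrow> 'b set \<Rightarrow> bool" where
  "isomorphic_reps a U b U' \<longleftrightarrow> (\<exists>\<phi>. rep_isomorphism a U b U' \<phi>)"

definition indecomposable :: "('s \<Rightarrow> 'a::real_vector \<Rightarrow> 'a) \<Rightarrow> 'a set \<Rightarrow> bool" where
  "indecomposable a W \<longleftrightarrow>
     W \<noteq> {0} \<and>
     \<not> (\<exists>Y Z. subrep a Y W \<and> subrep a Z W \<and> Y \<noteq> {0} \<and> Z \<noteq> {0} \<and>
              Y \<inter> Z = {0} \<and> W = {y + z | y z. y \<in> Y \<and> z \<in> Z})"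

definition internal_direct_sum :: "'a::real_vector set \<Rightarrow> 'k set \<Rightarrow> ('k \<Rightarrow> 'a set) \<Rightarrow> bool" where
  "internal_direct_sum X K Y \<longleftrightarrow>
     finite K \<and>
     X = {\<Sum>k\<in>K. y k | y. \<forall>k\<in>K. y k \<in> Y k} \<and>
     (\<forall>y. (\<forall>k\<in>K. y k \<in> Y k) \<and> (\<Sum>k\<in>K. y k) = 0 \<longrightarrow> (\<forall>k\<in>K. y k = 0))"

text \<open>
  \<open>X\<close> is isomorphic to the direct sum over \<open>i \<in> I\<close> of \<open>m i\<close> copies of \<open>W i\<close>: it is the internal
  direct sum of subrepresentations \<open>Y (i, j)\<close>, \<open>j < m i\<close>, with \<open>Y (i, j)\<close> isomorphic to \<open>W i\<close>.
\<close>

definition iso_direct_sum ::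
  "('s \<Rightarrow> 'a::real_vector \<Rightarrow> 'a) \<Rightarrow> 'a set \<Rightarrow> 'i set \<Rightarrow> ('i \<Rightarrow> nat) \<Rightarrow>
   ('s \<Rightarrow> 'b::real_vector \<Rightarrow> 'b) \<Rightarrow> ('i \<Rightarrow> 'b set) \<Rightarrow> bool" where
  "iso_direct_sum a X I m b W \<longleftrightarrow>
     (\<exists>Y. internal_direct_sum X (SIGMA i:I. {..<m i}) Y \<and>
          (\<forall>i\<in>I. \<forall>j<m i. subrep a (Y (i, j)) X \<and> isomorphic_reps b (W i) a (Y (i, j))))"

section \<open>Real, complex and quaternionic type\<close>

text \<open>Endomorphisms of \<open>W\<close> are represented by functions that are \<open>undefined\<close> outside \<open>W\<close>.\<close>

definition End_ring :: "('s \<Rightarrow> 'a::real_vector \<Rightarrow> 'a) \<Rightarrow> 'a set \<Rightarrow> ('a \<Rightarrow> 'a) ring" where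
  "End_ring a W =
     \<lparr>carrier = {f \<in> extensional W. linear_map W W f \<and> equivariant a W a f},
      mult = (\<lambda>f g. compose W f g),
      one = (\<lambda>x\<in>W. x),
      zero = (\<lambda>x\<in>W. 0),
      add = (\<lambda>f g. \<lambda>x\<in>W. f x + g x)\<rparr>"

definition left_ideal :: "'r set \<Rightarrow> ('r, 'm) ring_scheme \<Rightarrow> bool" where
  "left_ideal J R \<longleftrightarrow>
     additive_subgroup J R \<and> (\<forall>r\<in>carrier R. \<forall>x\<in>J. r \<otimes>\<^bsub>R\<^esub> x \<in> J)"

definition maximal_left_ideal :: "'r set \<Rightarrow> ('r, 'm) ring_scheme \<Rightarrow> bool" where
  "maximal_left_ideal J R \<longleftrightarrow>
     left_ideal J R \<and> J \<noteq> carrier R \<and>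
     (\<forall>J'. left_ideal J' R \<and> J \<subseteq> J' \<longrightarrow> J' = J \<or> J' = carrier R)"

definition jacobson_radical :: "('r, 'm) ring_scheme \<Rightarrow> 'r set" where
  "jacobson_radical R = carrier R \<inter> \<Inter>{J. maximal_left_ideal J R}"

definition real_ring :: "real ring" where
  "real_ring = \<lparr>carrier = UNIV, mult = (*), one = 1, zero = 0, add = (+)\<rparr>"

definition complex_ring :: "complex ring" where
  "complex_ring = \<lparr>carrier = UNIV, mult = (*), one = 1, zero = 0, add = (+)\<rparr>"

text \<open>The quadruple \<open>(p, q, r, s)\<close> stands for the quaternion \<open>p + q i + r j + s k\<close>.\<close>

fun quat_mult :: "real \<times> real \<times> real \<times> real \<Rightarrow> real \<times> real \<times> real \<times> real \<Rightarrow> real \<times> real \<times> real \<times> real" where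
  "quat_mult (p, q, r, s) (p', q', r', s') =
     (p * p' - q * q' - r * r' - s * s',
      p * q' + q * p' + r * s' - s * r',
      p * r' - q * s' + r * p' + s * q',
      p * s' + q * r' - r * q' + s * p')"

definition quaternion_ring :: "(real \<times> real \<times> real \<times> real) ring" where
  "quaternion_ring =
     \<lparr>carrier = UNIV, mult = quat_mult, one = (1, 0, 0, 0), zero = (0, 0, 0, 0), add = (+)\<rparr>"

text \<open>
  \<open>End(W)\<close> modulo its radical is isomorphic, as a real algebra, to the ring \<open>D\<close> whose scalars are
  embedded by \<open>e\<close>.
\<close>

definition End_mod_radical_iso ::
  "('s \<Rightarrow> 'a::real_vector \<Rightarrow> 'a) \<Rightarrow> 'a set \<Rightarrow> 'd ring \<Rightarrow> (real \<Rightarrow> 'd) \<Rightarrow> bool" where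
  "End_mod_radical_iso a W D e \<longleftrightarrow>
     (let E = End_ring a W; J = jacobson_radical E in
      \<exists>h \<in> ring_iso (E Quot J) D. \<forall>c. h (J +>\<^bsub>E\<^esub> (\<lambda>x\<in>W. c *\<^sub>R x)) = e c)"

definition real_type :: "('s \<Rightarrow> 'a::real_vector \<Rightarrow> 'a) \<Rightarrow> 'a set \<Rightarrow> bool" where
  "real_type a W \<longleftrightarrow> End_mod_radical_iso a W real_ring (\<lambda>c. c)"

definition complex_type :: "('s \<Rightarrow> 'a::real_vector \<Rightarrow> 'a) \<Rightarrow> 'a set \<Rightarrow> bool" where
  "complex_type a W \<longleftrightarrow> End_mod_radical_iso a W complex_ring complex_of_real"

definition quaternionic_type :: "('s \<Rightarrow> 'a::real_vector \<Rightarrow> 'a) \<Rightarrow> 'a set \<Rightarrow> bool" where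
  "quaternionic_type a W \<longleftrightarrow> End_mod_radical_iso a W quaternion_ring (\<lambda>c. (c, 0, 0, 0))"

section \<open>Smooth maps on subspaces\<close>

text \<open>
  For a nonzero linear subspace \<open>S\<close>, the derivative within \<open>S\<close> is unique on directions in \<open>S\<close>, and
  \<open>f\<close> is \<open>C\<^sup>k\<^sup>+\<^sup>1\<close> on \<open>S\<close> iff it is differentiable and all its directional derivatives along \<open>S\<close>
  are \<open>C\<^sup>k\<close>.
\<close>

primrec Ck_on :: "nat \<Rightarrow> 'a::euclidean_space set \<Rightarrow> ('a \<Rightarrow> 'b::real_normed_vector) \<Rightarrow> bool" where
  "Ck_on 0 S f \<longleftrightarrow> continuous_on S f"
| "Ck_on (Suc k) S f \<longleftrightarrow>
     f differentiable_on S \<and> (\<forall>h\<in>S. Ck_on k S (\<lambda>x. frechet_derivative f (at x within S) h))"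

definition smooth_on_subspace :: "'a::euclidean_space set \<Rightarrow> ('a \<Rightarrow> 'b::real_normed_vector) \<Rightarrow> bool" where
  "smooth_on_subspace S f \<longleftrightarrow> (\<forall>k. Ck_on k S f)"

section \<open>Eigenvalues and generalized eigenspaces\<close>

text \<open>Vectors \<open>x + i y\<close> of the complexification are represented by pairs \<open>(x, y)\<close>.\<close>

definition complex_scale :: "complex \<Rightarrow> 'a::real_vector \<times> 'a \<Rightarrow> 'a \<times> 'a" where
  "complex_scale z p =
     (Re z *\<^sub>R fst p - Im z *\<^sub>R snd p, Im z *\<^sub>R fst p + Re z *\<^sub>R snd p)"

definition eigenvalues_on :: "'a::real_vector set \<Rightarrow> ('a \<Rightarrow> 'a) \<Rightarrow> complex set" where
  "eigenvalues_on U L = {z. \<exists>p \<in> U \<times> U. p \<noteq> 0 \<and> map_prod L L p = complex_scale z p}"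

definition complex_generalized_eigenspace :: "('a::real_vector \<Rightarrow> 'a) \<Rightarrow> complex \<Rightarrow> ('a \<times> 'a) set" where
  "complex_generalized_eigenspace L z =
     {p. \<exists>k. ((\<lambda>q. map_prod L L q - complex_scale z q) ^^ k) p = 0}"

definition generalized_kernel :: "('a::real_vector \<Rightarrow> 'a) \<Rightarrow> 'a set" where
  "generalized_kernel L = {v. \<exists>k. (L ^^ k) v = 0}"

text \<open>
  The real parts of the complex generalized eigenspace for \<open>i \<omega>\<close> form the real generalized
  eigenspace belonging to the conjugate pair \<open>i \<omega>\<close>, \<open>- i \<omega>\<close>.
\<close>

definition center_subspace :: "('a::real_vector \<Rightarrow> 'a) \<Rightarrow> 'a set" where
  "center_subspace L = span (\<Union>\<omega>::real. fst ` complex_generalized_eigenspace L (Complex 0 \<omega>))"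

section \<open>Fundamental networks\<close>

text \<open>The direct sum of copies of the internal phase space \<open>'v\<close> over the monoid \<open>'s\<close>.\<close>

type_synonym ('v, 's) phase_space = "('v, 's) vec"

definition net_act :: "'s::{finite, monoid_mult} \<Rightarrow> ('v, 's) phase_space \<Rightarrow> ('v, 's) phase_space" where
  "net_act \<sigma> v = (\<chi> \<tau>. v $ (\<tau> * \<sigma>))"

text \<open>
  The arguments of the response function \<open>f\<close> are indexed by the elements of the monoid instead of
  by an enumeration of them; parameters range over \<open>real ^ 'l\<close>.
\<close>

definition admissible ::
  "(('v, 's::{finite, monoid_mult}) phase_space \<times> (real ^ ('l::finite)) \<Rightarrow> 'v) \<Rightarrow> ('v, 's) phase_space \<times> (real ^ 'l)
   \<Rightarrow> ('v, 's) phase_space" where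
  "admissible f p = (\<chi> \<sigma>. f (\<chi> \<tau>. fst p $ (\<tau> * \<sigma>), snd p))"

definition admissible_linearization ::
  "(('v::euclidean_space, 's::{finite, monoid_mult}) phase_space \<times> (real ^ ('l::finite)) \<Rightarrow> 'v) \<Rightarrow> ('v, 's) phase_space \<Rightarrow> ('v, 's) phase_space" where
  "admissible_linearization f =
     frechet_derivative (\<lambda>v. admissible f (v, 0)) (at 0)"

definition bifurcation_family ::
  "(('v::euclidean_space, 's::{finite, monoid_mult}) phase_space \<times> (real ^ ('l::finite)) \<Rightarrow> 'v) \<Rightarrow> bool" where
  "bifurcation_family f \<longleftrightarrow> smooth_on_subspace UNIV f \<and> admissible f (0, 0) = 0"

text \<open>
  A decomposition of the network phase space into indecomposables, where \<open>IR\<close>, \<open>IC\<close>, \<open>IH\<close> index the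
  summands of real, complex and quaternionic type and \<open>s\<close> gives the multiplicities.  Since every
  direct summand is isomorphic to a subrepresentation, the \<open>W i\<close> can be taken inside the phase space.
\<close>

definition network_decomposition ::
  "nat set \<Rightarrow> nat set \<Rightarrow> nat set \<Rightarrow> (nat \<Rightarrow> ('v::euclidean_space, 's::{finite, monoid_mult}) phase_space set) \<Rightarrow>
   (nat \<Rightarrow> nat) \<Rightarrow> bool" where
  "network_decomposition IR IC IH W s \<longleftrightarrow>
     (let I = IR \<union> IC \<union> IH in
      finite I \<and> IR \<inter> IC = {} \<and> IR \<inter> IH = {} \<and> IC \<inter> IH = {} \<and>
      (\<forall>i\<in>I. subrep net_act (W i) UNIV \<and> indecomposable net_act (W i) \<and> 0 < s i) \<and>
      (\<forall>i\<in>IR. real_type net_act (W i)) \<and>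
      (\<forall>i\<in>IC. complex_type net_act (W i)) \<and>
      (\<forall>i\<in>IH. quaternionic_type net_act (W i)) \<and>
      (\<forall>i\<in>I. \<forall>j\<in>I. i \<noteq> j \<longrightarrow> \<not> isomorphic_reps net_act (W i) net_act (W j)) \<and>
      iso_direct_sum net_act (UNIV :: ('v, 's) phase_space set) I s net_act W)"

text \<open>
  The classification conditions for generic \<open>l\<close>-parameter bifurcations: the multiplicities \<open>m\<close> of
  \<open>U\<close> satisfy \<open>K\<^sub>U \<le> l\<close> for generalized kernels and \<open>C\<^sub>U \<le> l\<close> for center subspaces.  By uniqueness
  of the decomposition it is irrelevant which one is chosen.
\<close>

definition kernel_condition :: "nat \<Rightarrow> ('v::euclidean_space, 's::{finite, monoid_mult}) phase_space set \<Rightarrow> bool" where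
  "kernel_condition l U \<longleftrightarrow>
     (\<exists>IR IC IH (W :: nat \<Rightarrow> ('v, 's) phase_space set) s m.
        network_decomposition IR IC IH W s \<and>
        (\<forall>i \<in> IR \<union> IC \<union> IH. m i \<le> s i) \<and>
        iso_direct_sum net_act U (IR \<union> IC \<union> IH) m net_act W \<and>
        (\<Sum>i\<in>IR. m i) + 2 * (\<Sum>i\<in>IC. m i) + 4 * (\<Sum>i\<in>IH. m i) \<le> l)"

definition center_condition :: "nat \<Rightarrow> ('v::euclidean_space, 's::{finite, monoid_mult}) phase_space set \<Rightarrow> bool" where
  "center_condition l U \<longleftrightarrow>
     (\<exists>IR IC IH (W :: nat \<Rightarrow> ('v, 's) phase_space set) s m.
        network_decomposition IR IC IH W s \<and>
        (\<forall>i \<in> IR \<union> IC \<union> IH. m i \<le> s i) \<and>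
        iso_direct_sum net_act U (IR \<union> IC \<union> IH) m net_act W \<and>
        (\<Sum>i\<in>IR. nat \<lceil>real (m i) / 2\<rceil>) + (\<Sum>i\<in>IC. m i) + (\<Sum>i\<in>IH. m i) \<le> l)"

text \<open>
  \<open>U\<close> is the generalized kernel (center subspace) of an actual admissible family with \<open>CARD('l)\<close>
  parameters, and it is one of those allowed by the classification of generic bifurcations.
\<close>

definition generic_generalized_kernel ::
  "('l::finite) itself \<Rightarrow> ('v::euclidean_space, 's::{finite, monoid_mult}) phase_space set \<Rightarrow> bool" where
  "generic_generalized_kernel L U \<longleftrightarrow>
     (\<exists>f :: ('v, 's) phase_space \<times> (real ^ 'l) \<Rightarrow> 'v.
        bifurcation_family f \<and> U = generalized_kernel (admissible_linearization f)) \<and>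
     kernel_condition CARD('l) U"

definition generic_center_subspace ::
  "('l::finite) itself \<Rightarrow> ('v::euclidean_space, 's::{finite, monoid_mult}) phase_space set \<Rightarrow> bool" where
  "generic_center_subspace L U \<longleftrightarrow>
     (\<exists>f :: ('v, 's) phase_space \<times> (real ^ 'l) \<Rightarrow> 'v.
        bifurcation_family f \<and> U = center_subspace (admissible_linearization f)) \<and>
     center_condition CARD('l) U"

section \<open>Reduced bifurcation problems\<close>

text \<open>
  Reduced problems on \<open>U\<close> are functions that are \<open>undefined\<close> outside \<open>U \<times> UNIV\<close>; the eigenvalues of
  the linearization are constrained to \<open>Z\<close>, which is \<open>{0}\<close> for Lyapunov-Schmidt reduction to the
  generalized kernel and the imaginary axis for center manifold reduction.
\<close>

definition reduced_problems ::
  "complex set \<Rightarrow> ('s \<Rightarrow> 'u::euclidean_space \<Rightarrow> 'u) \<Rightarrow> 'u set \<Rightarrow> ('u \<times> (real ^ ('l::finite)) \<Rightarrow> 'u) set" where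
  "reduced_problems Z a U =
     {r \<in> (U \<times> UNIV) \<rightarrow>\<^sub>E U.
        smooth_on_subspace (U \<times> UNIV) r \<and>
        (\<forall>x. equivariant a U a (\<lambda>u. r (u, x))) \<and>
        r (0, 0) = 0 \<and>
        eigenvalues_on U (frechet_derivative (\<lambda>u. r (u, 0)) (at 0 within U)) \<subseteq> Z}"

definition conjugate_problem ::
  "('u \<Rightarrow> 'w) \<Rightarrow> 'u set \<Rightarrow> 'w set \<Rightarrow> ('u \<times> (real ^ ('l::finite)) \<Rightarrow> 'u) \<Rightarrow> 'w \<times> (real ^ 'l) \<Rightarrow> 'w" where
  "conjugate_problem \<phi> U U' r =
     (\<lambda>(w, x) \<in> U' \<times> UNIV. \<phi> (r (inv_into U \<phi> w, x)))"

definition equivalent_reduced_problems ::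
  "('l::finite) itself \<Rightarrow> complex set \<Rightarrow> ('s \<Rightarrow> 'u::euclidean_space \<Rightarrow> 'u) \<Rightarrow> 'u set \<Rightarrow>
   ('s \<Rightarrow> 'w::euclidean_space \<Rightarrow> 'w) \<Rightarrow> 'w set \<Rightarrow> bool" where
  "equivalent_reduced_problems L Z a U b U' \<longleftrightarrow>
     (\<exists>\<phi>. rep_isomorphism a U b U' \<phi> \<and>
          bij_betw (conjugate_problem \<phi> U U')
            (reduced_problems Z a U :: ('u \<times> (real ^ 'l) \<Rightarrow> 'u) set)
            (reduced_problems Z b U' :: ('w \<times> (real ^ 'l) \<Rightarrow> 'w) set))"

end

theory Submission
  imports Defs
begin

text \<open>
  Fix one coordinate \<open>k\<close> of \<open>\<real>\<^sup>d\<close> and embed the network phase space for \<open>\<real>\<close> into the one for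
  \<open>\<real>\<^sup>d\<close> by putting every internal state into coordinate \<open>k\<close>.  This embedding is linear, injective
  and equivariant.  A response function \<open>f\<close> for \<open>\<real>\<close> extends to \<open>\<real>\<^sup>d\<close> by \<open>f\<close> in coordinate \<open>k\<close> and the
  state of the cell itself in the others; the linearization then acts as the identity on the new
  coordinates, which adds only the eigenvalue \<open>1\<close>, so the generalized kernel and the center subspace
  are the embedded old ones.  The phase space for \<open>\<real>\<^sup>d\<close> is a direct sum of \<open>d\<close> copies of that for
  \<open>\<real>\<close>, so its indecomposable summands are the embedded old ones with \<open>d\<close>-fold multiplicities, and
  the classification conditions carry over with unchanged types and multiplicities of \<open>U\<close>.
\<close>

section \<open>Smoothness on subspaces\<close>

text \<open>Restricting \<open>f\<close> to the line through \<open>x\<close> in direction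
  \<open>h\<close>, which stays in \<open>S\<close>, reduces the claim to uniqueness of an ordinary
  derivative at \<open>0\<close> in one real variable. On directions outside \<open>S\<close> the
  two derivatives may differ.\<close>

lemma has_derivative_unique_on_subspace:
  fixes f :: "'a::real_normed_vector \<Rightarrow> 'b::real_normed_vector"
  assumes "(f has_derivative D) (at x within S)" "(f has_derivative D') (at x within S)"
    and S: "subspace S" and x: "x \<in> S" and h: "h \<in> S"
  shows "D h = D' h"
proof -
  have line: "((\<lambda>t. x + t *\<^sub>R h) has_derivative (\<lambda>t. t *\<^sub>R h)) (at (0::real))"
    by (auto intro!: derivative_eq_intros)
  have sub: "range (\<lambda>t. x + t *\<^sub>R h) \<subseteq> S"
    using S x h by (auto intro: subspace_add subspace_scale)
  have "((\<lambda>t. f (x + t *\<^sub>R h)) has_derivative (\<lambda>t. E (t *\<^sub>R h))) (at 0)"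
    if "(f has_derivative E) (at x within S)" for E
    using has_derivative_in_compose[OF line, of f E] has_derivative_subset[OF that sub] by simp
  from has_derivative_unique[OF this[OF assms(1)] this[OF assms(2)]]
  have "(\<lambda>t. D (t *\<^sub>R h)) = (\<lambda>t. D' (t *\<^sub>R h))" .
  from fun_cong[OF this, of 1] show ?thesis by simp
qed

text \<open>\<open>frechet_derivative\<close> is a choice among possibly many derivatives within
  \<open>S\<close>. On directions from \<open>S\<close> every choice has the same value, so any
  known derivative \<open>D\<close> computes it.\<close>

lemma frechet_derivative_within_subspace:
  fixes f :: "'a::real_normed_vector \<Rightarrow> 'b::real_normed_vector"
  assumes "(f has_derivative D) (at x within S)" "subspace S" "x \<in> S" "h \<in> S"
  shows "frechet_derivative f (at x within S) h = D h"
proof -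
  have "f differentiable (at x within S)"
    using assms(1) by (auto simp: differentiable_def)
  then show ?thesis
    using has_derivative_unique_on_subspace assms by (metis frechet_derivative_works)
qed

lemma Ck_on_cong:
  assumes "\<And>x. x \<in> S \<Longrightarrow> f x = g x"
  shows "Ck_on k S f \<longleftrightarrow> Ck_on k S g"
proof -
  have *: "Ck_on k S g" if "Ck_on k S f" "\<And>x. x \<in> S \<Longrightarrow> f x = g x" for k and f g
    using that
  proof (induction k arbitrary: f g)
    case 0
    then show ?case using continuous_on_cong[of S S f g] by auto
  next
    case (Suc k)
    have der: "(f has_derivative D) (at x within S) \<longleftrightarrow> (g has_derivative D) (at x within S)"
      if "x \<in> S" for x D
      using Suc.prems(2) that
      by (metis has_derivative_transform)
    \<comment> \<open>Both sides are Hilbert choices for the same predicate, so they agree as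
      functions, including on directions outside \<open>S\<close>.\<close>
    have "frechet_derivative f (at x within S) = frechet_derivative g (at x within S)"
      if "x \<in> S" for x
      by (simp add: frechet_derivative_def der that)
    then have eq: "frechet_derivative f (at x within S) h = frechet_derivative g (at x within S) h"
      if "x \<in> S" for x h
      using that by simp
    have "Ck_on k S (\<lambda>x. frechet_derivative g (at x within S) h)" if "h \<in> S" for h
    proof (rule Suc.IH)
      show "Ck_on k S (\<lambda>x. frechet_derivative f (at x within S) h)"
        using Suc.prems(1) that by simp
    qed (rule eq)
    moreover have "g differentiable_on S"
      using Suc.prems(1) der by (auto simp: differentiable_on_def differentiable_def)
    ultimately show ?case by simp
  qed
  show ?thesis using *[of k f g] *[of k g f] assms by auto
qed

lemma Ck_on_const: 
  assumes "subspace S"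
  shows "Ck_on k S (\<lambda>x. c)"
proof (induction k arbitrary: c)
  case (Suc k)
  have "frechet_derivative (\<lambda>x. c) (at x within S) h = 0" if "x \<in> S" "h \<in> S" for x h
    by (rule frechet_derivative_within_subspace) (use assms that in auto)
  then have "Ck_on k S (\<lambda>x. frechet_derivative (\<lambda>x. c) (at x within S) h)" if "h \<in> S" for h
    using Suc[of 0] that by (subst Ck_on_cong[where g = "\<lambda>_. 0"]) auto
  then show ?case by auto
qed simp

lemma linear_has_derivative:
  fixes f :: "'a::euclidean_space \<Rightarrow> 'b::real_normed_vector"
  shows "linear f \<Longrightarrow> (f has_derivative f) F"
  by (simp add: bounded_linear_imp_has_derivative linear_conv_bounded_linear)

lemma has_derivative_linear_image:
  fixes B :: "'b::euclidean_space \<Rightarrow> 'c::real_normed_vector"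
  assumes "linear B" "(f has_derivative D) F"
  shows "((\<lambda>x. B (f x)) has_derivative (\<lambda>h. B (D h))) F"
  by (rule bounded_linear.has_derivative[OF _ assms(2)])
    (use assms(1) in \<open>simp add: linear_conv_bounded_linear\<close>)

text \<open>The derivative in direction \<open>h\<close> is the constant \<open>f h\<close>, so one
  differentiation leads to constant functions and a case split on \<open>k\<close> suffices.\<close>

lemma Ck_on_linear:
  fixes f :: "'a::euclidean_space \<Rightarrow> 'b::real_normed_vector"
  assumes "subspace S" "linear f"
  shows "Ck_on k S f"
proof (cases k)
  case 0
  then show ?thesis using assms by (simp add: linear_continuous_on linear_conv_bounded_linear)
next
  case (Suc k')
  have f: "(f has_derivative f) (at x within S)" for x
    using assms(2) by (simp add: bounded_linear_imp_has_derivative linear_conv_bounded_linear)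
  have "Ck_on k' S (\<lambda>x. frechet_derivative f (at x within S) h)" if "h \<in> S" for h
    using Ck_on_const[OF assms(1), of k' "f h"] frechet_derivative_within_subspace[OF f assms(1)] that
    by (subst Ck_on_cong[where g = "\<lambda>_. f h"]) auto
  with Suc f show ?thesis by (auto simp: differentiable_on_def differentiable_def)
qed

lemma Ck_on_add:
  assumes "subspace S" "Ck_on k S f" "Ck_on k S g"
  shows "Ck_on k S (\<lambda>x. f x + g x)"
  using assms(2,3)
proof (induction k arbitrary: f g)
  case 0
  then show ?case by (simp add: continuous_on_add)
next
  case (Suc k)
  have "frechet_derivative (\<lambda>x. f x + g x) (at x within S) h =
      frechet_derivative f (at x within S) h + frechet_derivative g (at x within S) h"
    if "x \<in> S" "h \<in> S" for x h
    by (rule frechet_derivative_within_subspace[OF has_derivative_add])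
      (use Suc.prems that assms(1) in \<open>auto simp: differentiable_on_def frechet_derivative_works\<close>)
  then have "Ck_on k S (\<lambda>x. frechet_derivative (\<lambda>x. f x + g x) (at x within S) h)" if "h \<in> S" for h
    using that Suc.prems Suc.IH
    by (subst Ck_on_cong[where g = "\<lambda>x. frechet_derivative f (at x within S) h + frechet_derivative g (at x within S) h"])
      simp_all
  then show ?case using Suc.prems by auto
qed

text \<open>By the chain rule the derivative along \<open>h\<close> is \<open>B\<close> applied to
  the derivative of \<open>f\<close> at \<open>A x\<close> along \<open>A h\<close>. This has the
  same shape with \<open>f\<close> replaced by one of its directional derivatives, so induction on
  \<open>k\<close> with \<open>f\<close> arbitrary goes through.\<close>

lemma Ck_on_linear_compose:
  fixes f :: "'a::euclidean_space \<Rightarrow> 'b::euclidean_space"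
    and A :: "'c::euclidean_space \<Rightarrow> 'a" and B :: "'b \<Rightarrow> 'd::real_normed_vector"
  assumes S: "subspace S" "subspace S'" "linear A" "A ` S' \<subseteq> S" and B: "linear B"
    and "Ck_on k S f"
  shows "Ck_on k S' (\<lambda>x. B (f (A x)))"
  using assms(6)
proof (induction k arbitrary: f)
  case 0
  have A: "continuous_on S' A" and B: "continuous_on UNIV B"
    using assms by (simp_all add: linear_continuous_on linear_conv_bounded_linear)
  have "continuous_on S' (\<lambda>x. f (A x))"
    using continuous_on_compose2[OF _ A assms(4)] 0 by simp
  from continuous_on_compose2[OF B this] show ?case by simp
next
  case (Suc k)
  have D: "((\<lambda>x. B (f (A x))) has_derivative
      (\<lambda>h. B (frechet_derivative f (at (A x) within S) (A h)))) (at x within S')" 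
    if "x \<in> S'" for x
  proof -
    have A': "(A has_derivative A) (at x within S')"
      using assms(3) by (rule linear_has_derivative)
    have "(f has_derivative frechet_derivative f (at (A x) within S)) (at (A x) within S)"
      using Suc.prems that assms(4) by (auto simp: differentiable_on_def frechet_derivative_works)
    from has_derivative_in_compose[OF A' has_derivative_subset[OF this assms(4)]]
    show ?thesis by (rule has_derivative_linear_image[OF B])
  qed
  have "frechet_derivative (\<lambda>x. B (f (A x))) (at x within S') h =
     B (frechet_derivative f (at (A x) within S) (A h))" if "x \<in> S'" "h \<in> S'" for x h
    by (rule frechet_derivative_within_subspace[OF D]) (use that S in auto)
  moreover have "Ck_on k S' (\<lambda>x. B (frechet_derivative f (at (A x) within S) (A h)))" if "h \<in> S'" for h
    by (rule Suc.IH) (use Suc.prems that assms(4) in auto)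
  ultimately have "Ck_on k S' (\<lambda>x. frechet_derivative (\<lambda>x. B (f (A x))) (at x within S') h)"
    if "h \<in> S'" for h
    using that
    by (subst Ck_on_cong[where g = "\<lambda>x. B (frechet_derivative f (at (A x) within S) (A h))"]) simp_all
  moreover have "(\<lambda>x. B (f (A x))) differentiable_on S'"
    using D by (auto simp: differentiable_on_def differentiable_def)
  ultimately show ?case by simp
qed

section \<open>Transport of reduced bifurcation problems along equivariant linear maps\<close>

lemma reduced_problem_differentiable:
  fixes r :: "'a::euclidean_space \<times> (real ^ ('b::finite)) \<Rightarrow> 'a"
  assumes r: "r \<in> reduced_problems Z a U" and U: "subspace U"
  shows "(\<lambda>u. r (u, 0)) differentiable (at 0 within U)"
proof -
  have r1: "Ck_on 1 (U \<times> UNIV) r"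
    using r by (auto simp: reduced_problems_def smooth_on_subspace_def)
  have "linear (\<lambda>u :: 'a. (u, 0 :: real ^ 'b))"
    by (intro linearI) auto
  from Ck_on_linear_compose[OF subspace_Times[OF U subspace_UNIV] U this _ linear_id r1]
  have "Ck_on 1 U (\<lambda>u. r (u, 0))" by auto
  then show ?thesis using U by (simp add: differentiable_on_def subspace_0)
qed

text \<open>Smoothness comes from composing with linear maps on both sides; an eigenvector of the
  new linearization is pulled back by \<open>\<psi>\<close>. The two maps are inverse to each other
  only between \<open>U\<close> and \<open>U'\<close>, which fits \<open>embed k\<close> and
  \<open>coordinate k\<close>, and the symmetric hypotheses let the lemma serve in both
  directions.\<close>

lemma reduced_problems_transport:
  fixes \<phi> :: "'u::euclidean_space \<Rightarrow> 'w::euclidean_space" and \<psi> :: "'w \<Rightarrow> 'u"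
    and r :: "'u \<times> (real ^ ('l::finite)) \<Rightarrow> 'u"
  assumes lin: "linear \<phi>" "linear \<psi>" and sub: "subspace U" "subspace U'"
    and \<phi>: "\<And>u. u \<in> U \<Longrightarrow> \<phi> u \<in> U' \<and> \<psi> (\<phi> u) = u"
    and \<psi>: "\<And>w. w \<in> U' \<Longrightarrow> \<psi> w \<in> U \<and> \<phi> (\<psi> w) = w"
    and equi: "equivariant a U b \<phi>" "equivariant b U' a \<psi>"
    and inv: "\<And>\<sigma> w. w \<in> U' \<Longrightarrow> b \<sigma> w \<in> U'"
    and r: "r \<in> reduced_problems Z a U"
  shows "(\<lambda>(w, x) \<in> U' \<times> UNIV. \<phi> (r (\<psi> w, x))) \<in> reduced_problems Z b U'"
    (is "?r' \<in> _")
proof -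
  have rU: "r (u, x) \<in> U" if "u \<in> U" for u x
    using r that by (auto simp: reduced_problems_def)
  have r'_eq: "?r' (w, x) = \<phi> (r (\<psi> w, x))" if "w \<in> U'" for w x
    using that by simp
  have "smooth_on_subspace (U' \<times> UNIV) ?r'"
    unfolding smooth_on_subspace_def
  proof
    fix k
    have rk: "Ck_on k (U \<times> UNIV) r"
      using r by (auto simp: reduced_problems_def smooth_on_subspace_def)
    have "linear (map_prod \<psi> id :: 'w \<times> (real ^ 'l) \<Rightarrow> _)"
      using lin by (intro linearI) (auto simp: linear_add linear_scale)
    from Ck_on_linear_compose[OF _ _ this _ lin(1) rk, of "U' \<times> UNIV"]
    have "Ck_on k (U' \<times> UNIV) (\<lambda>p. \<phi> (r (map_prod \<psi> id p)))"
      using sub \<psi> by (auto simp: subspace_Times)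
    then show "Ck_on k (U' \<times> UNIV) ?r'"
      by (subst Ck_on_cong[where g = "\<lambda>p. \<phi> (r (map_prod \<psi> id p))"]) (auto simp: r'_eq)
  qed
  moreover have "equivariant b U' b (\<lambda>u. ?r' (u, x))" for x
    using r inv \<psi> equi rU by (auto simp: equivariant_def reduced_problems_def)
  moreover have "z \<in> Z" if z: "z \<in> eigenvalues_on U' (frechet_derivative (\<lambda>u. ?r' (u, 0)) (at 0 within U'))" for z
  proof -
    define D where "D = frechet_derivative (\<lambda>u. r (u, 0)) (at 0 within U)"
    have D: "((\<lambda>u. r (u, 0)) has_derivative D) (at 0 within U)"
      using reduced_problem_differentiable[OF r sub(1)] by (simp add: D_def frechet_derivative_works)
    have \<phi>D: "((\<lambda>u. \<phi> (r (u, 0))) has_derivative (\<lambda>h. \<phi> (D h))) (at 0 within U)"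
      by (rule has_derivative_linear_image[OF lin(1) D])
    \<comment> \<open>On \<open>U\<close> the values \<open>r (u, 0)\<close> stay in
      \<open>U\<close>, so applying \<open>\<phi>\<close> and then \<open>\<psi>\<close> changes
      nothing. Uniqueness of the derivative then gives the same for the vectors \<open>D h\<close>,
      without a separate proof that \<open>D\<close> maps \<open>U\<close> into itself.\<close>
    then have "((\<lambda>u. \<psi> (\<phi> (r (u, 0)))) has_derivative (\<lambda>h. \<psi> (\<phi> (D h)))) (at 0 within U)"
      by (rule has_derivative_linear_image[OF lin(2)])
    then have "((\<lambda>u. r (u, 0)) has_derivative (\<lambda>h. \<psi> (\<phi> (D h)))) (at 0 within U)"
      by (rule has_derivative_transform[rotated 2]) (use sub \<phi> rU in \<open>auto simp: subspace_0\<close>)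
    then have \<psi>\<phi>D: "\<psi> (\<phi> (D h)) = D h" if "h \<in> U" for h
      using has_derivative_unique_on_subspace[OF _ D sub(1) subspace_0[OF sub(1)] that] by blast
    have "(\<psi> has_derivative \<psi>) (at 0 within U')"
      using lin(2) by (rule linear_has_derivative)
    moreover have "((\<lambda>u. \<phi> (r (u, 0))) has_derivative (\<lambda>h. \<phi> (D h))) (at (\<psi> 0) within \<psi> ` U')"
      using has_derivative_subset[OF \<phi>D, of "\<psi> ` U'"] \<psi> by (auto simp: linear_0[OF lin(2)])
    ultimately have "((\<lambda>w. \<phi> (r (\<psi> w, 0))) has_derivative (\<lambda>h. \<phi> (D (\<psi> h)))) (at 0 within U')"
      by (rule has_derivative_in_compose)
    then have "((\<lambda>w. ?r' (w, 0)) has_derivative (\<lambda>h. \<phi> (D (\<psi> h)))) (at 0 within U')"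
      by (rule has_derivative_transform[rotated 2]) (use sub in \<open>auto simp: subspace_0\<close>)
    then have D': "frechet_derivative (\<lambda>w. ?r' (w, 0)) (at 0 within U') h = \<phi> (D (\<psi> h))"
      if "h \<in> U'" for h
      using frechet_derivative_within_subspace[OF _ sub(2) subspace_0[OF sub(2)] that] by blast
    \<comment> \<open>\<open>p\<close> and \<open>q\<close> are the real and imaginary parts of an
      eigenvector for \<open>z\<close>; their images under \<open>\<psi>\<close> will form an
      eigenvector of \<open>D\<close> for the same \<open>z\<close>.\<close>
    obtain p q where pq: "p \<in> U'" "q \<in> U'" "(p, q) \<noteq> 0"
      and "(\<phi> (D (\<psi> p)), \<phi> (D (\<psi> q))) = complex_scale z (p, q)"
      using z D' by (auto simp: eigenvalues_on_def)
    then have e: "\<phi> (D (\<psi> p)) = Re z *\<^sub>R p - Im z *\<^sub>R q" "\<phi> (D (\<psi> q)) = Im z *\<^sub>R p + Re z *\<^sub>R q"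
      by (auto simp: complex_scale_def)
    have "D (\<psi> p) = \<psi> (Re z *\<^sub>R p - Im z *\<^sub>R q)" "D (\<psi> q) = \<psi> (Im z *\<^sub>R p + Re z *\<^sub>R q)"
      using pq \<psi> by (simp_all flip: e add: \<psi>\<phi>D)
    then have "map_prod D D (\<psi> p, \<psi> q) = complex_scale z (\<psi> p, \<psi> q)"
      using lin(2) by (simp add: complex_scale_def linear_add linear_diff linear_scale)
    moreover have "(\<psi> p, \<psi> q) \<in> U \<times> U" using pq \<psi> by auto
    moreover have "(\<psi> p, \<psi> q) \<noteq> 0"
    proof
      assume "(\<psi> p, \<psi> q) = 0"
      then have "\<phi> (\<psi> p) = 0" "\<phi> (\<psi> q) = 0"
        using lin(1) by (simp_all add: linear_0 zero_prod_def)
      then show False using pq \<psi> by (simp add: zero_prod_def)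
    qed
    ultimately have "z \<in> eigenvalues_on U D"
      unfolding eigenvalues_on_def by blast
    with r show ?thesis by (auto simp: reduced_problems_def D_def)
  qed
  moreover have "?r' (0, 0) = 0"
    using r lin sub by (auto simp: reduced_problems_def linear_0 subspace_0)
  moreover have "?r' \<in> (U' \<times> UNIV) \<rightarrow>\<^sub>E U'"
    using \<phi> \<psi> rU by auto
  ultimately show ?thesis
    unfolding reduced_problems_def by blast
qed

text \<open>Conjugation by \<open>\<psi>\<close> inverts conjugation by \<open>\<phi>\<close>. Since
  reduced problems are extensional, the two compositions only have to be compared on
  \<open>U \<times> UNIV\<close> and \<open>U' \<times> UNIV\<close>.\<close>

lemma equivalent_reduced_problemsI:
  fixes \<phi> :: "'u::euclidean_space \<Rightarrow> 'w::euclidean_space" and \<psi> :: "'w \<Rightarrow> 'u"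
  assumes lin: "linear \<phi>" "linear \<psi>" and sub: "subspace U" "subspace U'"
    and \<phi>: "\<And>u. u \<in> U \<Longrightarrow> \<phi> u \<in> U' \<and> \<psi> (\<phi> u) = u"
    and \<psi>: "\<And>w. w \<in> U' \<Longrightarrow> \<psi> w \<in> U \<and> \<phi> (\<psi> w) = w"
    and equi: "equivariant a U b \<phi>" "equivariant b U' a \<psi>"
    and inv: "\<And>\<sigma> u. u \<in> U \<Longrightarrow> a \<sigma> u \<in> U" "\<And>\<sigma> w. w \<in> U' \<Longrightarrow> b \<sigma> w \<in> U'"
  shows "equivalent_reduced_problems TYPE('l::finite) Z a U b U'"
proof -
  have bij: "bij_betw \<phi> U U'"
    using \<phi> \<psi> by (intro bij_betw_byWitness[where f' = \<psi>]) auto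
  have iso: "rep_isomorphism a U b U' \<phi>"
    using bij equi(1) lin(1) \<phi> by (auto simp: rep_isomorphism_def linear_map_def linear_add linear_scale)
  have inv_\<phi>: "inv_into U \<phi> w = \<psi> w" if "w \<in> U'" for w
    using that \<psi> bij by (metis bij_betw_def inv_into_f_f)
  have conj: "conjugate_problem \<phi> U U' r = (\<lambda>(w, x) \<in> U' \<times> UNIV. \<phi> (r (\<psi> w, x)))" for r :: "'u \<times> (real ^ 'l) \<Rightarrow> 'u"
    by (auto simp: conjugate_problem_def restrict_def inv_\<phi>)
  have "bij_betw (conjugate_problem \<phi> U U') (reduced_problems Z a U :: ('u \<times> (real ^ 'l) \<Rightarrow> 'u) set)
     (reduced_problems Z b U')"
  proof (rule bij_betw_byWitness[where f' = "\<lambda>s. \<lambda>(u, x) \<in> U \<times> UNIV. \<psi> (s (\<phi> u, x))"])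
    show "\<forall>r\<in>reduced_problems Z a U. (\<lambda>(u, x) \<in> U \<times> UNIV. \<psi> (conjugate_problem \<phi> U U' r (\<phi> u, x))) = (r :: 'u \<times> (real ^ 'l) \<Rightarrow> 'u)"
    proof
      fix r :: "'u \<times> (real ^ 'l) \<Rightarrow> 'u" assume "r \<in> reduced_problems Z a U"
      then have r: "r \<in> (U \<times> UNIV) \<rightarrow>\<^sub>E U" by (simp add: reduced_problems_def)
      show "(\<lambda>(u, x) \<in> U \<times> UNIV. \<psi> (conjugate_problem \<phi> U U' r (\<phi> u, x))) = r"
        by (rule extensionalityI[of _ "U \<times> UNIV"]) (use r \<phi> in \<open>auto simp: conj PiE_iff\<close>)
    qed
    show "\<forall>s\<in>reduced_problems Z b U'. conjugate_problem \<phi> U U' (\<lambda>(u, x) \<in> U \<times> UNIV. \<psi> (s (\<phi> u, x))) = (s :: 'w \<times> (real ^ 'l) \<Rightarrow> 'w)"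
    proof
      fix s :: "'w \<times> (real ^ 'l) \<Rightarrow> 'w" assume "s \<in> reduced_problems Z b U'"
      then have s: "s \<in> (U' \<times> UNIV) \<rightarrow>\<^sub>E U'" by (simp add: reduced_problems_def)
      show "conjugate_problem \<phi> U U' (\<lambda>(u, x) \<in> U \<times> UNIV. \<psi> (s (\<phi> u, x))) = s"
        by (rule extensionalityI[of _ "U' \<times> UNIV"]) (use s \<psi> in \<open>auto simp: conj PiE_iff\<close>)
    qed
    show "conjugate_problem \<phi> U U' ` reduced_problems Z a U \<subseteq> (reduced_problems Z b U' :: ('w \<times> (real ^ 'l) \<Rightarrow> 'w) set)"
      unfolding conj using reduced_problems_transport[OF lin sub \<phi> \<psi> equi inv(2)] by blast
    show "(\<lambda>s. \<lambda>(u, x) \<in> U \<times> UNIV. \<psi> (s (\<phi> u, x))) ` reduced_problems Z b U' \<subseteq> (reduced_problems Z a U :: ('u \<times> (real ^ 'l) \<Rightarrow> 'u) set)"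
      using reduced_problems_transport[OF lin(2,1) sub(2,1) \<psi> \<phi> equi(2,1) inv(1)] by blast
  qed
  with iso show ?thesis unfolding equivalent_reduced_problems_def by blast
qed

section \<open>Endomorphism rings modulo their radical\<close>

lemma ring_iso_add_inv:
  assumes "h \<in> ring_iso R S" "ring R" "ring S" "x \<in> carrier R"
  shows "h (\<ominus>\<^bsub>R\<^esub> x) = \<ominus>\<^bsub>S\<^esub> h x"
proof -
  interpret ring_hom_ring R S h
    using assms by (auto simp: ring_iso_def intro: ring_hom_ringI2)
  show ?thesis using assms(4) by simp
qed

text \<open>Closure under left multiplication rests on surjectivity of \<open>h\<close>: every
  multiplier in \<open>S\<close> is the image of one in \<open>R\<close>.\<close>

lemma left_ideal_image:
  assumes h: "h \<in> ring_iso R S" and "ring R" "ring S" and J: "left_ideal J R"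
  shows "left_ideal (h ` J) S"
proof -
  interpret R: ring R by fact
  interpret S: ring S by fact
  note hE = ring_iso_memE[OF h]
  interpret J: additive_subgroup J R using J by (simp add: left_ideal_def)
  have JR: "J \<subseteq> carrier R" by (rule J.a_subset)
  have "subgroup (h ` J) (add_monoid S)"
  proof
    show "h ` J \<subseteq> carrier (add_monoid S)" using JR hE(1) by auto
  next
    fix x y assume "x \<in> h ` J" "y \<in> h ` J"
    then show "x \<otimes>\<^bsub>add_monoid S\<^esub> y \<in> h ` J"
      using JR by (auto simp flip: hE(3) simp: subset_iff)
  next
    have "h \<zero>\<^bsub>R\<^esub> = \<zero>\<^bsub>S\<^esub>"
      using h ring_hom_zero assms(2,3) by (auto simp: ring_iso_def)
    then show "\<one>\<^bsub>add_monoid S\<^esub> \<in> h ` J"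
      using J.zero_closed by (metis image_eqI monoid.select_convs(2))
  next
    fix x assume "x \<in> h ` J"
    then obtain y where y: "y \<in> J" "x = h y" by auto
    then have "\<ominus>\<^bsub>S\<^esub> x = h (\<ominus>\<^bsub>R\<^esub> y)"
      using ring_iso_add_inv[OF h assms(2,3)] JR by auto
    then show "inv\<^bsub>add_monoid S\<^esub> x \<in> h ` J"
      using y J.a_inv_closed by (simp add: a_inv_def)
  qed
  moreover have "r \<otimes>\<^bsub>S\<^esub> x \<in> h ` J" if "r \<in> carrier S" "x \<in> h ` J" for r x
  proof -
    obtain r' where "r' \<in> carrier R" "r = h r'"
      using \<open>r \<in> carrier S\<close> hE(5) by (auto simp: bij_betw_def)
    moreover obtain y where "y \<in> J" "x = h y"
      using \<open>x \<in> h ` J\<close> by auto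
    ultimately show ?thesis
      using J JR by (auto simp flip: hE(2) simp: left_ideal_def subset_iff)
  qed
  ultimately show ?thesis
    by (simp add: left_ideal_def additive_subgroup_def)
qed

lemma left_ideal_subset: "left_ideal J R \<Longrightarrow> J \<subseteq> carrier R"
  by (simp add: left_ideal_def additive_subgroup.a_subset)

text \<open>A left ideal of \<open>S\<close> above the image of \<open>J\<close> is moved back to
  \<open>R\<close> by the inverse isomorphism \<open>?g\<close>, where maximality of
  \<open>J\<close> applies.\<close>

lemma maximal_left_ideal_image:
  assumes h: "h \<in> ring_iso R S" and R: "ring R" and S: "ring S" and J: "maximal_left_ideal J R"
  shows "maximal_left_ideal (h ` J) S"
proof -
  note bij = ring_iso_memE(5)[OF h]
  let ?g = "inv_into (carrier R) h"
  have g: "?g \<in> ring_iso S R" by (rule ring_iso_set_sym[OF R h])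
  have gh: "?g ` h ` K = K" if "K \<subseteq> carrier R" for K
    using bij that by (simp add: bij_betw_def)
  have hg: "h ` ?g ` K = K" if "K \<subseteq> carrier S" for K
    using bij that by (simp add: bij_betw_def image_inv_into_cancel)
  have JR: "J \<subseteq> carrier R" using J left_ideal_subset by (auto simp: maximal_left_ideal_def)
  have "h ` J \<noteq> carrier S"
    using J JR gh gh[of "carrier R"] bij by (metis bij_betw_def maximal_left_ideal_def order_refl)
  moreover have "K = h ` J \<or> K = carrier S" if K: "left_ideal K S" "h ` J \<subseteq> K" for K
  proof -
    have "left_ideal (?g ` K) R" by (rule left_ideal_image[OF g S R K(1)])
    moreover have "J \<subseteq> ?g ` K" using image_mono[OF K(2), of ?g] gh[OF JR] by simp
    ultimately have "?g ` K = J \<or> ?g ` K = carrier R" using J by (auto simp: maximal_left_ideal_def)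
    then show ?thesis using hg[OF left_ideal_subset[OF K(1)]] bij by (auto simp: bij_betw_def)
  qed
  ultimately show ?thesis
    using J left_ideal_image[OF h R S] by (auto simp: maximal_left_ideal_def)
qed

text \<open>The preimage of a maximal left ideal of \<open>S\<close> is a maximal left ideal of
  \<open>R\<close>, hence contains the radical of \<open>R\<close>.\<close>

lemma jacobson_radical_image_subset:
  assumes h: "h \<in> ring_iso R S" and R: "ring R" and S: "ring S"
  shows "h ` jacobson_radical R \<subseteq> jacobson_radical S"
proof -
  let ?g = "inv_into (carrier R) h"
  have g: "?g \<in> ring_iso S R" by (rule ring_iso_set_sym[OF R h])
  note bij = ring_iso_memE(5)[OF h]
  have "h x \<in> K" if x: "x \<in> jacobson_radical R" and K: "maximal_left_ideal K S" for x K
  proof -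
    have "x \<in> ?g ` K"
      using x maximal_left_ideal_image[OF g S R K] by (auto simp: jacobson_radical_def)
    moreover have "K \<subseteq> carrier S"
      using K left_ideal_subset by (auto simp: maximal_left_ideal_def)
    ultimately show ?thesis
      using bij by (auto simp: bij_betw_def f_inv_into_f subset_iff)
  qed
  then show ?thesis
    using ring_iso_memE(1)[OF h] by (auto simp: jacobson_radical_def)
qed

lemma jacobson_radical_image:
  assumes h: "h \<in> ring_iso R S" and R: "ring R" and S: "ring S"
  shows "h ` jacobson_radical R = jacobson_radical S"
proof -
  let ?g = "inv_into (carrier R) h"
  have "?g ` jacobson_radical S \<subseteq> jacobson_radical R"
    by (rule jacobson_radical_image_subset[OF ring_iso_set_sym[OF R h] S R])
  then have "h ` ?g ` jacobson_radical S \<subseteq> h ` jacobson_radical R" by blast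
  moreover have "h ` ?g ` jacobson_radical S = jacobson_radical S"
    using ring_iso_memE(5)[OF h] by (intro image_inv_into_cancel) (auto simp: bij_betw_def jacobson_radical_def)
  ultimately show ?thesis using jacobson_radical_image_subset[OF h R S] by auto
qed

text \<open>Stated for an arbitrary subset \<open>J\<close>, so that it applies without knowing that the radical,
  defined through left ideals, is two-sided.\<close>

lemma FactRing_image_ring_iso:
  assumes h: "h \<in> ring_iso R S" and J: "J \<subseteq> carrier R" and R: "ring R"
  shows "(`) h \<in> ring_iso (R Quot J) (S Quot (h ` J))"
    and "x \<in> carrier R \<Longrightarrow> h ` (J +>\<^bsub>R\<^esub> x) = h ` J +>\<^bsub>S\<^esub> h x"
proof -
  interpret ring R by fact
  note hE = ring_iso_memE[OF h]
  show coset: "h ` (J +>\<^bsub>R\<^esub> x) = h ` J +>\<^bsub>S\<^esub> h x" if "x \<in> carrier R" for x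
    using that J by (force simp: a_r_coset_def' hE(3) subset_iff)
  have sub: "J +>\<^bsub>R\<^esub> x \<subseteq> carrier R" if "x \<in> carrier R" for x
    using that J by (rule a_r_coset_subset_G[rotated])
  have carrR: "carrier (R Quot J) = (\<lambda>x. J +>\<^bsub>R\<^esub> x) ` carrier R"
    by (auto simp: FactRing_def A_RCOSETS_def')
  have carrS: "carrier (S Quot (h ` J)) = (\<lambda>x. h ` J +>\<^bsub>S\<^esub> x) ` carrier S"
    by (auto simp: FactRing_def A_RCOSETS_def')
  have subR: "A \<subseteq> carrier R" if "A \<in> carrier (R Quot J)" for A
    using that sub by (auto simp: carrR)
  show "(`) h \<in> ring_iso (R Quot J) (S Quot (h ` J))"
  proof (rule ring_iso_memI)
    fix A assume "A \<in> carrier (R Quot J)"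
    then show "h ` A \<in> carrier (S Quot (h ` J))"
      using coset hE(1) by (auto simp: carrR carrS)
  next
    fix A B assume AB: "A \<in> carrier (R Quot J)" "B \<in> carrier (R Quot J)"
    have ab: "a \<in> carrier R" "b \<in> carrier R" if "a \<in> A" "b \<in> B" for a b
      using AB subR that by auto
    \<comment> \<open>The product of two cosets is defined as a union over all pairs of
      representatives, so it commutes with images and independence of representatives does not
      enter.\<close>
    have "h ` (A \<otimes>\<^bsub>R Quot J\<^esub> B) = (\<Union>a\<in>A. \<Union>b\<in>B. h ` (J +>\<^bsub>R\<^esub> (a \<otimes>\<^bsub>R\<^esub> b)))"
      by (simp add: FactRing_def rcoset_mult_def image_UN)
    also have "\<dots> = (\<Union>a\<in>A. \<Union>b\<in>B. h ` J +>\<^bsub>S\<^esub> (h a \<otimes>\<^bsub>S\<^esub> h b))"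
      using ab by (intro SUP_cong refl) (simp add: coset hE(2))
    finally show "h ` (A \<otimes>\<^bsub>R Quot J\<^esub> B) = h ` A \<otimes>\<^bsub>S Quot h ` J\<^esub> h ` B"
      by (simp add: FactRing_def rcoset_mult_def)
    show "h ` (A \<oplus>\<^bsub>R Quot J\<^esub> B) = h ` A \<oplus>\<^bsub>S Quot h ` J\<^esub> h ` B"
      using ab by (force simp: FactRing_def set_add_def' hE(3))
  next
    show "h ` \<one>\<^bsub>R Quot J\<^esub> = \<one>\<^bsub>S Quot h ` J\<^esub>"
      by (simp add: FactRing_def coset hE(4))
  next
    have "inj_on ((`) h) (carrier (R Quot J))"
      using subR hE(5) by (intro inj_onI) (metis bij_betw_def inj_on_image_eq_iff)
    moreover have "(`) h ` carrier (R Quot J) = carrier (S Quot (h ` J))"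
    proof -
      have "(`) h ` carrier (R Quot J) = (\<lambda>x. h ` J +>\<^bsub>S\<^esub> h x) ` carrier R"
        unfolding carrR image_image by (intro image_cong refl coset)
      also have "\<dots> = (\<lambda>x. h ` J +>\<^bsub>S\<^esub> x) ` h ` carrier R"
        by (simp add: image_image)
      finally show ?thesis using hE(5) by (simp add: carrS bij_betw_def)
    qed
    ultimately show "bij_betw ((`) h) (carrier (R Quot J)) (carrier (S Quot h ` J))"
      by (simp add: bij_betw_def)
  qed
qed

section \<open>Endomorphism rings of isomorphic representations\<close>

lemma End_ring_is_ring:
  assumes "representation a W"
  shows "ring (End_ring a W)"
proof -
  have sub: "subspace W" and act: "\<And>\<sigma>. linear_map W W (a \<sigma>)"
    using assms by (auto simp: representation_def)
  have aW: "a \<sigma> x \<in> W" if "x \<in> W" for \<sigma> x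
    using act that by (auto simp: linear_map_def Pi_iff)
  have W: "0 \<in> W" "\<And>x y. x \<in> W \<Longrightarrow> y \<in> W \<Longrightarrow> x + y \<in> W"
    "\<And>x c. x \<in> W \<Longrightarrow> c *\<^sub>R x \<in> W"
    using sub by (auto simp: subspace_0 subspace_add subspace_scale)
  have a0: "a \<sigma> 0 = 0" for \<sigma>
    using act[of \<sigma>] W(1) sub subspace_0[of W]
    unfolding linear_map_def by (metis scaleR_zero_left)
  have E: "f \<in> carrier (End_ring a W) \<longleftrightarrow>
      f \<in> extensional W \<and> linear_map W W f \<and> equivariant a W a f" for f
    by (simp add: End_ring_def)
  \<comment> \<open>The witness for additive inverses, which the ring record itself does not
    carry.\<close>
  have neg: "(\<lambda>x\<in>W. - f x) \<in> carrier (End_ring a W)" if "f \<in> carrier (End_ring a W)" for f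
  proof -
    have f: "f x \<in> W" if "x \<in> W" for x
      using \<open>f \<in> _\<close> that by (auto simp: E linear_map_def)
    have "a \<sigma> (- y) = - a \<sigma> y" if "y \<in> W" for \<sigma> y
      using act[of \<sigma>] that unfolding linear_map_def by (metis scaleR_minus1_left)
    then show ?thesis
      using that f sub aW
      by (auto simp: E linear_map_def equivariant_def Pi_iff subspace_neg subspace_add subspace_scale)
  qed
  show ?thesis
  proof (rule ringI)
    show "abelian_group (End_ring a W)"
    proof (rule abelian_groupI)
      fix f g assume "f \<in> carrier (End_ring a W)" "g \<in> carrier (End_ring a W)"
      then show "f \<oplus>\<^bsub>End_ring a W\<^esub> g \<in> carrier (End_ring a W)"
        using act aW W unfolding E
        by (auto simp: End_ring_def linear_map_def equivariant_def Pi_iff algebra_simps)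
    next
      show "\<zero>\<^bsub>End_ring a W\<^esub> \<in> carrier (End_ring a W)"
        using aW a0 sub unfolding E
        by (auto simp: End_ring_def linear_map_def equivariant_def subspace_0 subspace_add subspace_scale)
    next
      fix f assume f: "f \<in> carrier (End_ring a W)"
      show "\<exists>g\<in>carrier (End_ring a W). g \<oplus>\<^bsub>End_ring a W\<^esub> f = \<zero>\<^bsub>End_ring a W\<^esub>"
        by (rule bexI[OF _ neg[OF f]]) (auto simp: End_ring_def fun_eq_iff restrict_def)
      show "\<zero>\<^bsub>End_ring a W\<^esub> \<oplus>\<^bsub>End_ring a W\<^esub> f = f"
        using f unfolding E by (auto simp: End_ring_def fun_eq_iff restrict_def extensional_def)
    qed (auto simp: End_ring_def fun_eq_iff restrict_def)
    show "monoid (End_ring a W)"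
    proof (rule monoidI)
      fix f g assume "f \<in> carrier (End_ring a W)" "g \<in> carrier (End_ring a W)"
      then show "f \<otimes>\<^bsub>End_ring a W\<^esub> g \<in> carrier (End_ring a W)"
        using aW W unfolding E
        by (auto simp: End_ring_def linear_map_def equivariant_def Pi_iff compose_eq)
    next
      show "\<one>\<^bsub>End_ring a W\<^esub> \<in> carrier (End_ring a W)"
        using aW W unfolding E by (auto simp: End_ring_def linear_map_def equivariant_def)
    next
      fix f g h
      assume "f \<in> carrier (End_ring a W)" "g \<in> carrier (End_ring a W)" "h \<in> carrier (End_ring a W)"
      then show "f \<otimes>\<^bsub>End_ring a W\<^esub> g \<otimes>\<^bsub>End_ring a W\<^esub> h = f \<otimes>\<^bsub>End_ring a W\<^esub> (g \<otimes>\<^bsub>End_ring a W\<^esub> h)"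
        unfolding E by (auto simp: End_ring_def fun_eq_iff compose_def restrict_def linear_map_def Pi_iff)
    next
      fix f assume "f \<in> carrier (End_ring a W)"
      then show "\<one>\<^bsub>End_ring a W\<^esub> \<otimes>\<^bsub>End_ring a W\<^esub> f = f" "f \<otimes>\<^bsub>End_ring a W\<^esub> \<one>\<^bsub>End_ring a W\<^esub> = f"
        unfolding E
        by (auto simp: End_ring_def fun_eq_iff compose_def restrict_def linear_map_def Pi_iff extensional_def)
    qed
  next
    fix f g h
    assume "f \<in> carrier (End_ring a W)" "g \<in> carrier (End_ring a W)" "h \<in> carrier (End_ring a W)"
    then show "(f \<oplus>\<^bsub>End_ring a W\<^esub> g) \<otimes>\<^bsub>End_ring a W\<^esub> h =
        f \<otimes>\<^bsub>End_ring a W\<^esub> h \<oplus>\<^bsub>End_ring a W\<^esub> g \<otimes>\<^bsub>End_ring a W\<^esub> h"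
      and "h \<otimes>\<^bsub>End_ring a W\<^esub> (f \<oplus>\<^bsub>End_ring a W\<^esub> g) =
        h \<otimes>\<^bsub>End_ring a W\<^esub> f \<oplus>\<^bsub>End_ring a W\<^esub> h \<otimes>\<^bsub>End_ring a W\<^esub> g"
      unfolding E
      by (auto simp: End_ring_def fun_eq_iff compose_def restrict_def linear_map_def Pi_iff)
  qed
qed

text \<open>The isomorphism is conjugation by \<open>\<phi>\<close>, cut off outside
  \<open>W'\<close> because elements of \<open>End_ring\<close> are extensional; conjugation by the
  inverse of \<open>\<phi>\<close> undoes it.\<close>

lemma End_ring_iso:
  assumes iso: "rep_isomorphism a W b W' \<phi>" and a: "representation a W" and b: "representation b W'"
  defines "h \<equiv> \<lambda>f. \<lambda>x\<in>W'. \<phi> (f (inv_into W \<phi> x))"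
  shows "h \<in> ring_iso (End_ring a W) (End_ring b W')"
proof -
  define \<psi> where "\<psi> = inv_into W \<phi>"
  have bij: "bij_betw \<phi> W W'" using iso by (simp add: rep_isomorphism_def)
  have \<phi>: "\<phi> x \<in> W'" "\<psi> (\<phi> x) = x" if "x \<in> W" for x
    using bij that by (auto simp: \<psi>_def bij_betw_def)
  have \<psi>: "\<psi> y \<in> W" "\<phi> (\<psi> y) = y" if "y \<in> W'" for y
    using bij that by (auto simp: \<psi>_def bij_betw_def f_inv_into_f inv_into_into)
  have sub: "subspace W" "subspace W'" using a b by (auto simp: representation_def)
  have W: "\<And>x y. x \<in> W \<Longrightarrow> y \<in> W \<Longrightarrow> x + y \<in> W"
    "\<And>x c. x \<in> W \<Longrightarrow> c *\<^sub>R x \<in> W"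
    using sub by (auto simp: subspace_add subspace_scale)
  have W': "\<And>x y. x \<in> W' \<Longrightarrow> y \<in> W' \<Longrightarrow> x + y \<in> W'"
    "\<And>x c. x \<in> W' \<Longrightarrow> c *\<^sub>R x \<in> W'"
    using sub by (auto simp: subspace_add subspace_scale)
  have aW: "a \<sigma> x \<in> W" if "x \<in> W" for \<sigma> x
    using a that by (auto simp: representation_def linear_map_def)
  have bW': "b \<sigma> x \<in> W'" if "x \<in> W'" for \<sigma> x
    using b that by (auto simp: representation_def linear_map_def)
  have \<phi>lin: "\<And>x y. x \<in> W \<Longrightarrow> y \<in> W \<Longrightarrow> \<phi> (x + y) = \<phi> x + \<phi> y"
    "\<And>x c. x \<in> W \<Longrightarrow> \<phi> (c *\<^sub>R x) = c *\<^sub>R \<phi> x"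
    using iso by (auto simp: rep_isomorphism_def linear_map_def)
  have \<psi>lin: "\<And>x y. x \<in> W' \<Longrightarrow> y \<in> W' \<Longrightarrow> \<psi> (x + y) = \<psi> x + \<psi> y"
    "\<And>x c. x \<in> W' \<Longrightarrow> \<psi> (c *\<^sub>R x) = c *\<^sub>R \<psi> x"
    by (metis \<psi> \<phi> W(1) \<phi>lin(1)) (metis \<psi> \<phi> W(2) \<phi>lin(2))
  have \<phi>eq: "\<phi> (a \<sigma> x) = b \<sigma> (\<phi> x)" if "x \<in> W" for \<sigma> x
    using iso that by (auto simp: rep_isomorphism_def equivariant_def)
  have \<psi>eq: "\<psi> (b \<sigma> x) = a \<sigma> (\<psi> x)" if "x \<in> W'" for \<sigma> x
    using that \<psi> \<phi> aW \<phi>eq by metis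
  have EW: "\<And>x. x \<in> W \<Longrightarrow> f x \<in> W"
      "\<And>x y. x \<in> W \<Longrightarrow> y \<in> W \<Longrightarrow> f (x + y) = f x + f y"
      "\<And>x c. x \<in> W \<Longrightarrow> f (c *\<^sub>R x) = c *\<^sub>R f x"
      "\<And>x \<sigma>. x \<in> W \<Longrightarrow> f (a \<sigma> x) = a \<sigma> (f x)"
      "f \<in> extensional W"
    if "f \<in> carrier (End_ring a W)" for f
    using that by (auto simp: End_ring_def linear_map_def equivariant_def)
  have EW': "\<And>x. x \<in> W' \<Longrightarrow> f x \<in> W'"
      "\<And>x y. x \<in> W' \<Longrightarrow> y \<in> W' \<Longrightarrow> f (x + y) = f x + f y"
      "\<And>x c. x \<in> W' \<Longrightarrow> f (c *\<^sub>R x) = c *\<^sub>R f x"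
      "\<And>x \<sigma>. x \<in> W' \<Longrightarrow> f (b \<sigma> x) = b \<sigma> (f x)"
      "f \<in> extensional W'"
    if "f \<in> carrier (End_ring b W')" for f
    using that by (auto simp: End_ring_def linear_map_def equivariant_def)
  have closed: "h f \<in> carrier (End_ring b W')" if "f \<in> carrier (End_ring a W)" for f
    using EW[OF that] \<phi> \<psi> W W' \<phi>lin \<psi>lin \<phi>eq \<psi>eq bW'
    by (simp add: End_ring_def linear_map_def equivariant_def h_def add: Pi_iff flip: \<psi>_def)
  have closed': "(\<lambda>x\<in>W. \<psi> (f (\<phi> x))) \<in> carrier (End_ring a W)" if "f \<in> carrier (End_ring b W')" for f
    using EW'[OF that] \<phi> \<psi> W W' \<phi>lin \<psi>lin \<phi>eq \<psi>eq aW
    by (simp add: End_ring_def linear_map_def equivariant_def Pi_iff)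
  have ext: "f \<in> extensional W" if "f \<in> carrier (End_ring a W)" for f
    using that by (simp add: End_ring_def)
  have ext': "f \<in> extensional W'" if "f \<in> carrier (End_ring b W')" for f
    using that by (simp add: End_ring_def)
  show ?thesis
  proof (rule ring_iso_memI)
    fix f g assume "f \<in> carrier (End_ring a W)" "g \<in> carrier (End_ring a W)"
    then show "h (f \<otimes>\<^bsub>End_ring a W\<^esub> g) = h f \<otimes>\<^bsub>End_ring b W'\<^esub> h g"
      and "h (f \<oplus>\<^bsub>End_ring a W\<^esub> g) = h f \<oplus>\<^bsub>End_ring b W'\<^esub> h g"
      using EW(1) \<phi> \<psi> \<phi>lin
      by (auto simp: h_def End_ring_def compose_def restrict_def fun_eq_iff simp flip: \<psi>_def)
  next
    show "h \<one>\<^bsub>End_ring a W\<^esub> = \<one>\<^bsub>End_ring b W'\<^esub>"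
      using \<psi> by (auto simp: h_def End_ring_def restrict_def fun_eq_iff simp flip: \<psi>_def)
  next
    show "bij_betw h (carrier (End_ring a W)) (carrier (End_ring b W'))"
    proof (rule bij_betw_byWitness[where f' = "\<lambda>f. \<lambda>x\<in>W. \<psi> (f (\<phi> x))"])
      show "\<forall>f\<in>carrier (End_ring a W). (\<lambda>x\<in>W. \<psi> (h f (\<phi> x))) = f"
        using EW(1) \<phi> \<psi> ext by (intro ballI extensionalityI[of _ W]) (auto simp: h_def simp flip: \<psi>_def)
      show "\<forall>f\<in>carrier (End_ring b W'). h (\<lambda>x\<in>W. \<psi> (f (\<phi> x))) = f"
        using EW'(1) \<phi> \<psi> ext' by (intro ballI extensionalityI[of _ W']) (auto simp: h_def simp flip: \<psi>_def)
    qed (use closed closed' in auto)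
  qed (rule closed)
qed

text \<open>A ring isomorphism matches the radicals and so descends to the quotients. Compatibility
  with \<open>e\<close> is checked separately, since \<open>D\<close> has to be reached by an
  isomorphism of real algebras.\<close>

lemma End_mod_radical_iso_transport:
  assumes iso: "rep_isomorphism a W b W' \<phi>" and a: "representation a W" and b: "representation b W'"
    and D: "End_mod_radical_iso a W D e"
  shows "End_mod_radical_iso b W' D e"
proof -
  define h where "h = (\<lambda>f. \<lambda>x\<in>W'. \<phi> (f (inv_into W \<phi> x)))"
  define E where "E = End_ring a W"
  define E' where "E' = End_ring b W'"
  have h: "h \<in> ring_iso E E'"
    unfolding h_def E_def E'_def by (rule End_ring_iso[OF iso a b])
  have E: "ring E" "ring E'"
    using End_ring_is_ring a b by (auto simp: E_def E'_def)
  \<comment> \<open>The inverse runs from \<open>E'\<close> back to \<open>E\<close>, so the map it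
    induces on cosets can be followed by the given isomorphism onto \<open>D\<close>.\<close>
  define g where "g = inv_into (carrier E) h"
  have g: "g \<in> ring_iso E' E" unfolding g_def by (rule ring_iso_set_sym[OF E(1) h])
  define J where "J = jacobson_radical E"
  define J' where "J' = jacobson_radical E'"
  have J': "J' \<subseteq> carrier E'" by (simp add: J'_def jacobson_radical_def)
  have gJ: "g ` J' = J" unfolding J_def J'_def by (rule jacobson_radical_image[OF g E(2,1)])
  obtain q where q: "q \<in> ring_iso (E Quot J) D" "\<And>c. q (J +>\<^bsub>E\<^esub> (\<lambda>x\<in>W. c *\<^sub>R x)) = e c"
    using D by (auto simp: End_mod_radical_iso_def Let_def E_def J_def)
  have "q \<circ> (`) g \<in> ring_iso (E' Quot J') D"
    using ring_iso_set_trans[OF FactRing_image_ring_iso(1)[OF g J' E(2)]] q(1) by (simp add: gJ)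
  \<comment> \<open>By linearity of \<open>\<phi>\<close>, conjugation carries multiplication by
    \<open>c\<close> on \<open>W\<close> to multiplication by \<open>c\<close> on
    \<open>W'\<close>.\<close>
  moreover have "(q \<circ> (`) g) (J' +>\<^bsub>E'\<^esub> (\<lambda>x\<in>W'. c *\<^sub>R x)) = e c" for c
  proof -
    have sc: "(\<lambda>x\<in>W. c *\<^sub>R x) \<in> carrier E"
      using a by (auto simp: E_def End_ring_def representation_def linear_map_def equivariant_def
          subspace_add subspace_scale algebra_simps)
    have "h (\<lambda>x\<in>W. c *\<^sub>R x) = (\<lambda>x\<in>W'. c *\<^sub>R x)"
    proof (rule extensionalityI[of _ W'])
      fix x assume x: "x \<in> W'"
      then have "inv_into W \<phi> x \<in> W" "\<phi> (inv_into W \<phi> x) = x"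
        using iso by (auto simp: rep_isomorphism_def bij_betw_def f_inv_into_f inv_into_into)
      then show "h (\<lambda>x\<in>W. c *\<^sub>R x) x = (\<lambda>x\<in>W'. c *\<^sub>R x) x"
        using x iso by (simp add: h_def rep_isomorphism_def linear_map_def)
    qed (auto simp: h_def)
    then have "g (\<lambda>x\<in>W'. c *\<^sub>R x) = (\<lambda>x\<in>W. c *\<^sub>R x)" "(\<lambda>x\<in>W'. c *\<^sub>R x) \<in> carrier E'"
      using sc ring_iso_memE(1,5)[OF h] by (metis g_def bij_betw_def inv_into_f_f, metis)
    then show ?thesis
      using FactRing_image_ring_iso(2)[OF g J' E(2)] by (simp add: gJ q(2))
  qed
  ultimately show ?thesis
    unfolding End_mod_radical_iso_def Let_def E'_def[symmetric] J'_def[symmetric] by blast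
qed

section \<open>Direct sums of representations under embeddings\<close>

text \<open>Inclusion of the \<open>k\<close>-th summand when the phase space for
  \<open>real ^ 'd\<close> is read as a direct sum of copies of the one for \<open>real\<close>;
  \<open>coordinate k\<close> is the matching projection.\<close>

definition embed :: "'d \<Rightarrow> (real, 's::finite) phase_space \<Rightarrow> (real ^ 'd::finite, 's) phase_space" where
  "embed k v = (\<chi> \<sigma>. axis k (v $ \<sigma>))"

definition coordinate :: "'d \<Rightarrow> (real ^ 'd::finite, 's::finite) phase_space \<Rightarrow> (real, 's) phase_space" where
  "coordinate k w = (\<chi> \<sigma>. w $ \<sigma> $ k)"

lemma linear_embed: "linear (embed k)"
  by (intro linearI) (auto simp: embed_def vec_eq_iff axis_def)

lemma linear_coordinate: "linear (coordinate k)"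
  by (intro linearI) (auto simp: coordinate_def vec_eq_iff)

lemma coordinate_embed: "coordinate j (embed k v) = (if j = k then v else 0)"
  by (auto simp: coordinate_def embed_def vec_eq_iff axis_def)

lemma coordinate_embed_same [simp]: "coordinate k (embed k v) = v"
  by (simp add: coordinate_embed)

lemma inj_embed: "inj (embed k)"
  by (metis coordinate_embed_same injI)

lemma embed_0 [simp]: "embed k 0 = 0"
  by (simp add: linear_0 linear_embed)

lemma coordinate_0 [simp]: "coordinate k 0 = 0"
  by (simp add: linear_0 linear_coordinate)

text \<open>Together with \<open>coordinate_embed\<close>, this exhibits the large phase space as a
  direct sum of \<open>CARD('d)\<close> copies of the small one.\<close>

lemma sum_embed_coordinate: "(\<Sum>k\<in>UNIV. embed k (coordinate k w)) = w"
  by (simp add: embed_def coordinate_def vec_eq_iff axis_def if_distrib cong: if_cong)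

lemma embed_net_act: "embed k (net_act \<sigma> v) = net_act \<sigma> (embed k v)"
  by (simp add: embed_def net_act_def vec_eq_iff)

lemma coordinate_net_act: "coordinate k (net_act \<sigma> w) = net_act \<sigma> (coordinate k w)"
  by (simp add: coordinate_def net_act_def vec_eq_iff)

lemma linear_net_act: "linear (net_act \<sigma> :: ('v::real_vector, 's::{finite, monoid_mult}) phase_space \<Rightarrow> _)"
  by (intro linearI) (auto simp: net_act_def vec_eq_iff)

lemma subrep_imp_representation:
  fixes W :: "('v::real_vector, 's::{finite, monoid_mult}) phase_space set"
  assumes "subrep net_act W X"
  shows "representation net_act W"
proof -
  \<comment> \<open>Right translation of indices gives a left action: in the second equation both
    sides read \<open>x\<close> at the index multiplied on the right by
    \<open>\<sigma> * \<tau>\<close>.\<close>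
  have "net_act 1 x = x" "net_act (\<sigma> * \<tau>) x = net_act \<sigma> (net_act \<tau> x)"
    for x :: "('v, 's) phase_space" and \<sigma> \<tau>
    by (auto simp: net_act_def vec_eq_iff mult.assoc)
  then show ?thesis
    using assms by (auto simp: subrep_def representation_def linear_map_def
      linear_add[OF linear_net_act] linear_scale[OF linear_net_act])
qed

lemma isomorphic_reps_trans:
  assumes "isomorphic_reps a U b V" "isomorphic_reps b V c W"
  shows "isomorphic_reps a U c W"
proof -
  obtain \<phi> \<theta> where f: "rep_isomorphism a U b V \<phi>" and g: "rep_isomorphism b V c W \<theta>"
    using assms by (auto simp: isomorphic_reps_def)
  then have "bij_betw (\<theta> \<circ> \<phi>) U W"
    by (auto simp: rep_isomorphism_def intro: bij_betw_trans)
  moreover have "linear_map U W (\<theta> \<circ> \<phi>)" "equivariant a U c (\<theta> \<circ> \<phi>)"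
    using f g by (auto simp: rep_isomorphism_def linear_map_def equivariant_def Pi_iff)
  ultimately show ?thesis by (auto simp: isomorphic_reps_def rep_isomorphism_def)
qed

lemma internal_direct_sum_decompose:
  assumes "internal_direct_sum X K Y" "x \<in> X"
  obtains y where "\<And>k. k \<in> K \<Longrightarrow> y k \<in> Y k" "x = (\<Sum>k\<in>K. y k)"
  using assms unfolding internal_direct_sum_def by blast

lemma internal_direct_sum_mem:
  assumes "internal_direct_sum X K Y" "\<And>k. k \<in> K \<Longrightarrow> y k \<in> Y k"
  shows "(\<Sum>k\<in>K. y k) \<in> X"
  using assms unfolding internal_direct_sum_def by blast

lemma internal_direct_sum_unique:
  assumes "internal_direct_sum X K Y" "\<And>k. k \<in> K \<Longrightarrow> y k \<in> Y k" "(\<Sum>k\<in>K. y k) = 0" "k \<in> K"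
  shows "y k = 0"
  using assms unfolding internal_direct_sum_def by blast

text \<open>An equivariant linear injection between ambient spaces. It carries subrepresentations,
  indecomposability and direct sums over to images, whatever the concrete embedding is.\<close>

locale rep_embedding =
  fixes J :: "'a::real_vector \<Rightarrow> 'b::real_vector" and a :: "'s \<Rightarrow> 'a \<Rightarrow> 'a" and b :: "'s \<Rightarrow> 'b \<Rightarrow> 'b"
  assumes linear: "linear J" and inj: "inj J" and equi: "\<And>\<sigma> x. J (a \<sigma> x) = b \<sigma> (J x)"
begin

lemma rep_isomorphism_image: "rep_isomorphism a W b (J ` W) J"
  using inj by (auto simp: rep_isomorphism_def linear_map_def equivariant_def equi
      linear_add[OF linear] linear_scale[OF linear] intro: inj_on_imp_bij_betw inj_on_subset)

lemma isomorphic_reps_image: "isomorphic_reps a W b (J ` W)"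
  using rep_isomorphism_image by (auto simp: isomorphic_reps_def)

text \<open>With transitivity, this lets chains of isomorphisms pass from an embedded representation
  back to the original.\<close>

lemma isomorphic_reps_image_sym:
  assumes "\<And>\<sigma> x. x \<in> W \<Longrightarrow> a \<sigma> x \<in> W" "subspace W"
  shows "isomorphic_reps b (J ` W) a W"
proof -
  define g where "g = inv_into UNIV J"
  have inv: "g (J x) = x" for x using inj by (simp add: g_def)
  have "rep_isomorphism b (J ` W) a W g"
    unfolding rep_isomorphism_def
  proof (intro conjI)
    show "bij_betw g (J ` W) W"
      by (intro bij_betw_byWitness[where f' = J]) (auto simp: inv)
    show "linear_map (J ` W) W g"
      by (auto simp: linear_map_def inv simp flip: linear_add[OF linear] linear_scale[OF linear])
    show "equivariant b (J ` W) a g"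
      by (auto simp: equivariant_def inv simp flip: equi)
  qed
  then show ?thesis by (auto simp: isomorphic_reps_def)
qed

lemma subrep_image: "subrep a Y X \<Longrightarrow> subrep b (J ` Y) (J ` X)"
  using linear_subspace_image[OF linear] by (auto simp: subrep_def simp flip: equi)

lemma subrep_vimage:
  assumes "subrep b Y (J ` X)"
  shows "subrep a (J -` Y) X"
  unfolding subrep_def
proof (intro conjI allI ballI)
  show "subspace (J -` Y)"
    using assms linear_subspace_vimage[OF linear] by (auto simp: subrep_def)
  show "J -` Y \<subseteq> X"
  proof
    fix x assume "x \<in> J -` Y"
    then have "J x \<in> J ` X" using assms by (auto simp: subrep_def)
    then show "x \<in> X" by (simp only: inj_image_mem_iff[OF inj])
  qed
  show "a \<sigma> y \<in> J -` Y" if "y \<in> J -` Y" for \<sigma> y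
    using that assms by (auto simp: subrep_def equi)
qed

text \<open>A splitting of the image would pull back along \<open>J\<close> to a splitting of
  \<open>W\<close>.\<close>

lemma indecomposable_image:
  assumes W: "indecomposable a W"
  shows "indecomposable b (J ` W)"
  unfolding indecomposable_def
proof (intro conjI notI)
  have inj_0: "J x = 0 \<longleftrightarrow> x = 0" for x
    using inj linear_0[OF linear] by (metis injD)
  show False if "J ` W = {0}"
  proof -
    have "J ` W = J ` {0}" using that linear_0[OF linear] by simp
    then have "W = {0}" by (simp only: inj_image_eq_iff[OF inj])
    with W show False by (simp add: indecomposable_def)
  qed
  assume "\<exists>Y Z. subrep b Y (J ` W) \<and> subrep b Z (J ` W) \<and> Y \<noteq> {0} \<and> Z \<noteq> {0} \<and>
      Y \<inter> Z = {0} \<and> J ` W = {y + z | y z. y \<in> Y \<and> z \<in> Z}"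
  then obtain Y Z where YZ: "subrep b Y (J ` W)" "subrep b Z (J ` W)" "Y \<noteq> {0}" "Z \<noteq> {0}"
      "Y \<inter> Z = {0}" and sum: "J ` W = {y + z | y z. y \<in> Y \<and> z \<in> Z}" by blast
  \<comment> \<open>Both summands lie in the range of \<open>J\<close>, so taking preimages loses
    nothing.\<close>
  have J: "J ` J -` Y = Y" "J ` J -` Z = Z"
    using YZ by (auto simp: subrep_def)
  have "J -` Y \<noteq> {0}" "J -` Z \<noteq> {0}"
    using J YZ(3,4) linear_0[OF linear] by (metis image_empty image_insert)+
  moreover have "J -` Y \<inter> J -` Z = {0}"
  proof -
    have "J -` Y \<inter> J -` Z = J -` {0}" using YZ(5) by blast
    then show ?thesis using inj_0 by auto
  qed
  moreover have "W = {y + z | y z. y \<in> J -` Y \<and> z \<in> J -` Z}"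
  proof -
    have "J ` W = J ` {y + z | y z. y \<in> J -` Y \<and> z \<in> J -` Z}"
    proof (intro equalityI subsetI)
      fix w assume "w \<in> J ` W"
      then obtain y z where "y \<in> Y" "z \<in> Z" "w = y + z" using sum by auto
      moreover obtain y' z' where "y = J y'" "z = J z'"
        using calculation J by blast
      ultimately have "w = J (y' + z')" "y' \<in> J -` Y" "z' \<in> J -` Z"
        by (auto simp: linear_add[OF linear])
      then show "w \<in> J ` {y + z | y z. y \<in> J -` Y \<and> z \<in> J -` Z}" by blast
    next
      fix w assume "w \<in> J ` {y + z | y z. y \<in> J -` Y \<and> z \<in> J -` Z}"
      then obtain y z where "w = J y + J z" "J y \<in> Y" "J z \<in> Z"
        by (auto simp: linear_add[OF linear])
      then show "w \<in> J ` W" unfolding sum by blast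
    qed
    then show ?thesis using inj by (simp add: inj_image_eq_iff)
  qed
  ultimately have "\<exists>Y Z. subrep a Y W \<and> subrep a Z W \<and> Y \<noteq> {0} \<and> Z \<noteq> {0} \<and>
      Y \<inter> Z = {0} \<and> W = {y + z | y z. y \<in> Y \<and> z \<in> Z}"
    using subrep_vimage[OF YZ(1)] subrep_vimage[OF YZ(2)]
    by (intro exI[of _ "J -` Y"] exI[of _ "J -` Z"] conjI)
  with W show False
    unfolding indecomposable_def by (elim conjE notE)
qed

lemma internal_direct_sum_image:
  assumes X: "internal_direct_sum X K Y"
  shows "internal_direct_sum (J ` X) K (\<lambda>k. J ` Y k)"
  unfolding internal_direct_sum_def
proof (intro conjI allI impI ballI)
  show "finite K" using X by (simp add: internal_direct_sum_def)
  \<comment> \<open>Preimages of all summands are chosen at once, so that the whole sum becomes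
    \<open>J\<close> of a sum. This serves both for the spanning claim and, with injectivity of
    \<open>J\<close>, for independence.\<close>
  have pull: "\<exists>u. (\<forall>k\<in>K. u k \<in> Y k \<and> y k = J (u k)) \<and> (\<Sum>k\<in>K. y k) = J (\<Sum>k\<in>K. u k)"
    if "\<forall>k\<in>K. y k \<in> J ` Y k" for y
  proof -
    have "\<forall>k\<in>K. \<exists>u. u \<in> Y k \<and> y k = J u" using that by auto
    from bchoice[OF this] obtain u where u: "\<forall>k\<in>K. u k \<in> Y k \<and> y k = J (u k)" by blast
    then show ?thesis by (auto simp: linear_sum[OF linear] intro!: exI[of _ u])
  qed
  show "J ` X = {\<Sum>k\<in>K. y k | y. \<forall>k\<in>K. y k \<in> J ` Y k}"
  proof (intro equalityI subsetI)
    fix w assume "w \<in> J ` X"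
    then obtain y where "\<forall>k\<in>K. y k \<in> Y k" "w = J (\<Sum>k\<in>K. y k)"
      using internal_direct_sum_decompose[OF X] by (metis imageE)
    then show "w \<in> {\<Sum>k\<in>K. y k | y. \<forall>k\<in>K. y k \<in> J ` Y k}"
      by (auto simp: linear_sum[OF linear] intro!: exI[of _ "\<lambda>k. J (y k)"])
  next
    fix w assume "w \<in> {\<Sum>k\<in>K. y k | y. \<forall>k\<in>K. y k \<in> J ` Y k}"
    then obtain u where "\<forall>k\<in>K. u k \<in> Y k" "w = J (\<Sum>k\<in>K. u k)"
      using pull by (smt (verit) mem_Collect_eq)
    then show "w \<in> J ` X"
      using internal_direct_sum_mem[OF X, of u] by blast
  qed
  fix y k assume y: "(\<forall>k\<in>K. y k \<in> J ` Y k) \<and> (\<Sum>k\<in>K. y k) = 0" and k: "k \<in> K"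
  then obtain u where u: "\<forall>k\<in>K. u k \<in> Y k \<and> y k = J (u k)" "0 = J (\<Sum>k\<in>K. u k)"
    using pull[of y] by auto
  then have "(\<Sum>k\<in>K. u k) = 0"
    using inj linear_0[OF linear] by (metis injD)
  then have "u k = 0" using internal_direct_sum_unique[OF X, of u] u(1) k by blast
  then show "y k = 0" using u(1) k linear_0[OF linear] by simp
qed

text \<open>The models \<open>W i\<close> are replaced by their images too. The isomorphisms are
  chained from the image of \<open>W i\<close> through \<open>W i\<close> and
  \<open>Y (i, j)\<close> to the image of \<open>Y (i, j)\<close>.\<close>

lemma iso_direct_sum_image:
  assumes U: "iso_direct_sum a U I m a W"
    and W: "\<And>i. i \<in> I \<Longrightarrow> subrep a (W i) X"
  shows "iso_direct_sum b (J ` U) I m b (\<lambda>i. J ` W i)"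
proof -
  obtain Y where Y': "internal_direct_sum U (SIGMA i:I. {..<m i}) Y \<and>
      (\<forall>i\<in>I. \<forall>j<m i. subrep a (Y (i, j)) U \<and> isomorphic_reps a (W i) a (Y (i, j)))"
    using U unfolding iso_direct_sum_def by (elim exE)
  have Y: "internal_direct_sum U (SIGMA i:I. {..<m i}) Y"
    using Y' by (rule conjunct1)
  have Y2: "subrep a (Y (i, j)) U \<and> isomorphic_reps a (W i) a (Y (i, j))" if "i \<in> I" "j < m i" for i j
    using conjunct2[OF Y'] that by blast
  have "isomorphic_reps b (J ` W i) b (J ` Y (i, j))" if "i \<in> I" "j < m i" for i j
    using Y2[OF that] W[OF that(1)] isomorphic_reps_image[of "Y (i, j)"] isomorphic_reps_image_sym[of "W i"]
    by (meson isomorphic_reps_trans subrep_def)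
  then show ?thesis
    unfolding iso_direct_sum_def using internal_direct_sum_image[OF Y] Y2 subrep_image
    by (intro exI[of _ "\<lambda>k. J ` Y k"]) auto
qed

end

interpretation embed: rep_embedding "embed k" net_act net_act for k
  by (intro rep_embedding.intro linear_embed inj_embed) (rule embed_net_act)

section \<open>Decomposing the enlarged phase space\<close>

text \<open>\<open>iso_direct_sum\<close> prescribes index sets of the shape
  \<open>SIGMA i:I. {..<m i}\<close>; this lemma brings sums indexed by pairs of a summand and a
  coordinate into that shape.\<close>

lemma internal_direct_sum_reindex:
  assumes X: "internal_direct_sum X K Y" and \<beta>: "bij_betw \<beta> K' K"
  shows "internal_direct_sum X K' (Y \<circ> \<beta>)"
  unfolding internal_direct_sum_def
proof (intro conjI allI impI ballI)
  let ?g = "inv_into K' \<beta>"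
  have g: "bij_betw ?g K K'" using \<beta> by (rule bij_betw_inv_into)
  have \<beta>g: "\<beta> (?g k) = k" if "k \<in> K" for k
    using \<beta> that by (simp add: bij_betw_def f_inv_into_f)
  have g\<beta>: "?g (\<beta> k) = k" if "k \<in> K'" for k
    using \<beta> that by (simp add: bij_betw_def)
  have in_K: "\<beta> k \<in> K" if "k \<in> K'" for k
    using \<beta> that by (auto simp: bij_betw_def)
  have in_K': "?g k \<in> K'" if "k \<in> K" for k
    using g that by (auto simp: bij_betw_def)
  show "finite K'"
    using \<beta> X bij_betw_finite by (auto simp: internal_direct_sum_def)
  have sum_g: "(\<Sum>k\<in>K. y (?g k)) = (\<Sum>k\<in>K'. y k)" for y :: "_ \<Rightarrow> 'a"
    by (rule sum.reindex_bij_betw[OF g])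
  have sum_\<beta>: "(\<Sum>k\<in>K'. y (\<beta> k)) = (\<Sum>k\<in>K. y k)" for y :: "_ \<Rightarrow> 'a"
    by (rule sum.reindex_bij_betw[OF \<beta>])
  show "X = {\<Sum>k\<in>K'. y k | y. \<forall>k\<in>K'. y k \<in> (Y \<circ> \<beta>) k}"
  proof (intro equalityI subsetI)
    fix x assume "x \<in> X"
    then obtain y where "\<forall>k\<in>K. y k \<in> Y k" "x = (\<Sum>k\<in>K. y k)"
      using internal_direct_sum_decompose[OF X] by metis
    then show "x \<in> {\<Sum>k\<in>K'. y k | y. \<forall>k\<in>K'. y k \<in> (Y \<circ> \<beta>) k}"
      using sum_\<beta>[of y] in_K by (intro CollectI exI[of _ "\<lambda>k. y (\<beta> k)"]) simp
  next
    fix x assume "x \<in> {\<Sum>k\<in>K'. y k | y. \<forall>k\<in>K'. y k \<in> (Y \<circ> \<beta>) k}"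
    then obtain y where y: "\<forall>k\<in>K'. y k \<in> Y (\<beta> k)" "x = (\<Sum>k\<in>K'. y k)" by auto
    have "\<forall>k\<in>K. y (?g k) \<in> Y k" using y(1) \<beta>g in_K' by fastforce
    then show "x \<in> X"
      using internal_direct_sum_mem[OF X, of "\<lambda>k. y (?g k)"] y(2) sum_g[of y] by simp
  qed
  fix y k assume y: "(\<forall>k\<in>K'. y k \<in> (Y \<circ> \<beta>) k) \<and> (\<Sum>k\<in>K'. y k) = 0" and k: "k \<in> K'"
  have "\<forall>k\<in>K. y (?g k) \<in> Y k" using y \<beta>g in_K' by fastforce
  moreover have "(\<Sum>k\<in>K. y (?g k)) = 0" using y sum_g[of y] by simp
  ultimately have "\<forall>k\<in>K. y (?g k) = 0"
    using internal_direct_sum_unique[OF X, of "\<lambda>k. y (?g k)"] by blast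
  then show "y k = 0" using g\<beta> in_K k by fastforce
qed

text \<open>Each coordinate of a vector is decomposed separately and embedded back. For
  independence, \<open>coordinate k\<close> kills all summands sitting in other coordinates and
  leaves a vanishing sum in the original decomposition.\<close>

lemma internal_direct_sum_all_coordinates:
  assumes X: "internal_direct_sum (UNIV :: (real, 's::finite) phase_space set) K Y"
  shows "internal_direct_sum (UNIV :: (real ^ 'd::finite, 's) phase_space set) (K \<times> UNIV)
    (\<lambda>(\<kappa>, k). embed k ` Y \<kappa>)"
  unfolding internal_direct_sum_def
proof (intro conjI allI impI ballI)
  have fin: "finite K" using X by (simp add: internal_direct_sum_def)
  then show "finite (K \<times> (UNIV :: 'd set))" by simp
  show "(UNIV :: (real ^ 'd, 's) phase_space set) =
      {\<Sum>p\<in>K \<times> UNIV. y p | y. \<forall>p\<in>K \<times> UNIV. y p \<in> (case p of (\<kappa>, k) \<Rightarrow> embed k ` Y \<kappa>)}"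
  proof (intro equalityI subsetI)
    fix w :: "(real ^ 'd, 's) phase_space"
    have "\<exists>y. (\<forall>\<kappa>\<in>K. y \<kappa> \<in> Y \<kappa>) \<and> coordinate k w = (\<Sum>\<kappa>\<in>K. y \<kappa>)" for k
      using internal_direct_sum_decompose[OF X UNIV_I] by metis
    then obtain y where y: "\<And>k. \<forall>\<kappa>\<in>K. y k \<kappa> \<in> Y \<kappa>" "\<And>k. coordinate k w = (\<Sum>\<kappa>\<in>K. y k \<kappa>)"
      by metis
    have "w = (\<Sum>k\<in>UNIV. \<Sum>\<kappa>\<in>K. embed k (y k \<kappa>))"
      by (subst sum_embed_coordinate[of w, symmetric]) (simp add: y(2) linear_sum[OF linear_embed])
    also have "\<dots> = (\<Sum>(\<kappa>, k)\<in>K \<times> UNIV. embed k (y k \<kappa>))"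
      by (subst sum.swap) (simp add: sum.cartesian_product)
    finally show "w \<in> {\<Sum>p\<in>K \<times> UNIV. y p | y. \<forall>p\<in>K \<times> UNIV. y p \<in> (case p of (\<kappa>, k) \<Rightarrow> embed k ` Y \<kappa>)}"
      using y(1) by (intro CollectI exI[of _ "\<lambda>(\<kappa>, k). embed k (y k \<kappa>)"]) auto
  qed simp
  fix y :: "_ \<Rightarrow> (real ^ 'd, 's) phase_space" and p
  assume y: "(\<forall>p\<in>K \<times> UNIV. y p \<in> (case p of (\<kappa>, k) \<Rightarrow> embed k ` Y \<kappa>)) \<and>
      (\<Sum>p\<in>K \<times> UNIV. y p) = 0" and p: "p \<in> K \<times> (UNIV :: 'd set)"
  obtain \<kappa> k where \<kappa>: "p = (\<kappa>, k)" "\<kappa> \<in> K" using p by auto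
  define u where "u \<kappa> k = coordinate k (y (\<kappa>, k))" for \<kappa> k
  have u: "u \<kappa> k \<in> Y \<kappa>" "y (\<kappa>, k) = embed k (u \<kappa> k)" if "\<kappa> \<in> K" for \<kappa> k
  proof -
    have "y (\<kappa>, k) \<in> embed k ` Y \<kappa>" using y that by auto
    then show "u \<kappa> k \<in> Y \<kappa>" "y (\<kappa>, k) = embed k (u \<kappa> k)" by (auto simp: u_def)
  qed
  have "0 = coordinate k (\<Sum>p\<in>K \<times> UNIV. y p)" using y by simp
  also have "(\<Sum>p\<in>K \<times> UNIV. y p) = (\<Sum>\<kappa>\<in>K. \<Sum>j\<in>UNIV. embed j (u \<kappa> j))"
    by (subst sum.cartesian_product) (auto intro!: sum.cong simp: u(2))
  also have "coordinate k \<dots> = (\<Sum>\<kappa>\<in>K. \<Sum>j\<in>UNIV. if k = j then u \<kappa> j else 0)"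
    by (simp add: linear_sum[OF linear_coordinate] coordinate_embed)
  also have "\<dots> = (\<Sum>\<kappa>\<in>K. u \<kappa> k)" by simp
  finally have "(\<Sum>\<kappa>\<in>K. u \<kappa> k) = 0" by (rule sym)
  then have "u \<kappa> k = 0"
    using u(1) \<kappa>(2) by (intro internal_direct_sum_unique[OF X, of "\<lambda>\<kappa>. u \<kappa> k"])
  then show "y p = 0" using \<kappa> u(2) by simp
qed

text \<open>Division with remainder by \<open>s i\<close>: the remainder selects one of the
  \<open>s i\<close> old copies, and the quotient selects a coordinate through the enumeration
  \<open>e\<close>.\<close>

lemma bij_betw_mult_index:
  fixes e :: "nat \<Rightarrow> 'd::finite"
  assumes e: "bij_betw e {..<CARD('d)} UNIV" and s: "\<And>i. i \<in> I \<Longrightarrow> 0 < s i"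
  shows "bij_betw (\<lambda>(i, n). ((i, n mod s i), e (n div s i)))
    (SIGMA i:I. {..<CARD('d) * s i}) ((SIGMA i:I. {..<s i}) \<times> UNIV)"
proof -
  define e' where "e' = inv_into {..<CARD('d)} e"
  have e': "e' k < CARD('d)" "e (e' k) = k" for k
    using e by (auto simp: e'_def bij_betw_def f_inv_into_f
        dest: inv_into_into[of k e "{..<CARD('d)}" for k] intro: inv_into_into[of _ e "{..<CARD('d)}", simplified])
  have e'_e: "e' (e n) = n" if "n < CARD('d)" for n
    using e that by (simp add: e'_def bij_betw_def)
  have div: "n div s i < CARD('d)" if "n < CARD('d) * s i" for n i
    using that by (simp add: less_mult_imp_div_less)
  have bound: "k * m + j < d * m" if "j < m" "k < d" for j k m d :: nat
  proof -
    have "k * m + j < Suc k * m" using that(1) by simp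
    also have "\<dots> \<le> d * m" using that(2) by (intro mult_le_mono1) simp
    finally show ?thesis .
  qed
  show ?thesis
    by (rule bij_betw_byWitness[where f' = "\<lambda>((i, j), k). (i, e' k * s i + j)"])
      (auto simp: e' e'_e div s bound)
qed

text \<open>The summands are spread over all coordinates while the models all sit in coordinate
  \<open>k0\<close>; passing through \<open>W i\<close> identifies them.\<close>

lemma iso_direct_sum_all_coordinates:
  fixes W :: "nat \<Rightarrow> (real, 's::{finite, monoid_mult}) phase_space set" and k0 :: "'d::finite"
  assumes U: "iso_direct_sum net_act (UNIV :: (real, 's) phase_space set) I s net_act W"
    and W: "\<And>i. i \<in> I \<Longrightarrow> subrep net_act (W i) UNIV" and s: "\<And>i. i \<in> I \<Longrightarrow> 0 < s i"
  shows "iso_direct_sum net_act (UNIV :: (real ^ 'd, 's) phase_space set) I (\<lambda>i. CARD('d) * s i)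
    net_act (\<lambda>i. embed k0 ` W i)"
proof -
  obtain Y :: "_ \<Rightarrow> (real, 's) phase_space set" where Y': "internal_direct_sum UNIV (SIGMA i:I. {..<s i}) Y \<and>
      (\<forall>i\<in>I. \<forall>j<s i. subrep net_act (Y (i, j)) UNIV \<and> isomorphic_reps net_act (W i) net_act (Y (i, j)))"
    using U unfolding iso_direct_sum_def by (elim exE)
  have Y: "internal_direct_sum UNIV (SIGMA i:I. {..<s i}) Y"
    using Y' by (rule conjunct1)
  have Y2: "subrep net_act (Y (i, j)) UNIV \<and> isomorphic_reps net_act (W i) net_act (Y (i, j))" if "i \<in> I" "j < s i" for i j
    using conjunct2[OF Y'] that by blast
  obtain e where e: "bij_betw e {..<CARD('d)} (UNIV :: 'd set)"
    using ex_bij_betw_nat_finite[of "UNIV :: 'd set"] by (auto simp: atLeast0LessThan)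
  let ?\<beta> = "\<lambda>(i, n). ((i, n mod s i), e (n div s i))"
  define Z where "Z = (\<lambda>(\<kappa>, k :: 'd). embed k ` Y \<kappa>) \<circ> ?\<beta>"
  have Z_sum: "internal_direct_sum UNIV (SIGMA i:I. {..<CARD('d) * s i}) Z"
    unfolding Z_def using internal_direct_sum_all_coordinates[OF Y] bij_betw_mult_index[OF e s]
    by (rule internal_direct_sum_reindex)
  have Z_iso: "subrep net_act (Z (i, n)) UNIV \<and> isomorphic_reps net_act (embed k0 ` W i) net_act (Z (i, n))"
    if "i \<in> I" "n < CARD('d) * s i" for i n
  proof -
    have Yi: "subrep net_act (Y (i, n mod s i)) UNIV" "isomorphic_reps net_act (W i) net_act (Y (i, n mod s i))"
      using Y2[OF that(1)] s[OF that(1)] by auto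
    have Z: "Z (i, n) = embed (e (n div s i)) ` Y (i, n mod s i)" by (simp add: Z_def)
    have "subrep net_act (Z (i, n)) UNIV"
      using embed.subrep_image[OF Yi(1)] unfolding Z
      by (auto simp: subrep_def)
    moreover have "isomorphic_reps net_act (embed k0 ` W i) net_act (Z (i, n))"
    proof -
      have "isomorphic_reps net_act (embed k0 ` W i) net_act (W i)"
      proof (rule embed.isomorphic_reps_image_sym)
        show "subspace (W i)" using W[OF that(1)] by (simp add: subrep_def)
        show "net_act \<sigma> x \<in> W i" if "x \<in> W i" for \<sigma> x
          using W[OF \<open>i \<in> I\<close>] that by (simp add: subrep_def)
      qed
      from isomorphic_reps_trans[OF isomorphic_reps_trans[OF this Yi(2)]
          embed.isomorphic_reps_image]
      show ?thesis unfolding Z .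
    qed
    ultimately show ?thesis ..
  qed
  show ?thesis
    unfolding iso_direct_sum_def
    by (rule exI[of _ Z], rule conjI, rule Z_sum, intro ballI allI impI, rule Z_iso)
qed

section \<open>Adding internal dimensions\<close>

lemma iso_direct_sum_embed:
  fixes W :: "'i \<Rightarrow> (real, 's::{finite, monoid_mult}) phase_space set" and k :: "'d::finite"
  assumes "iso_direct_sum net_act U I m net_act W" "\<And>i. i \<in> I \<Longrightarrow> subrep net_act (W i) UNIV"
  shows "iso_direct_sum net_act (embed k ` U) I m net_act (\<lambda>i. embed k ` W i)"
  using assms by (rule embed.iso_direct_sum_image)

text \<open>Keeping \<open>D\<close> and \<open>e\<close> arbitrary treats the real, complex and
  quaternionic types at once.\<close>

lemma End_mod_radical_iso_embed:
  fixes W :: "(real, 's::{finite, monoid_mult}) phase_space set" and k :: "'d::finite"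
  assumes W: "subrep net_act W UNIV" and "End_mod_radical_iso net_act W D e"
  shows "End_mod_radical_iso net_act (embed k ` W) D e"
proof (rule End_mod_radical_iso_transport[OF embed.rep_isomorphism_image])
  show "representation net_act W" by (rule subrep_imp_representation[OF W])
  show "representation net_act (embed k ` W)"
    by (rule subrep_imp_representation[OF embed.subrep_image[OF W]])
qed fact

lemma subrep_UNIV: "subrep a Y X \<Longrightarrow> subrep a Y UNIV"
  by (simp add: subrep_def)

text \<open>Used in contrapositive form: embedded models remain pairwise non-isomorphic.\<close>

lemma not_isomorphic_reps_embed:
  fixes W W' :: "(real, 's::{finite, monoid_mult}) phase_space set" and k :: "'d::finite"
  assumes W': "subrep net_act W' UNIV"
    and iso: "isomorphic_reps net_act (embed k ` W) net_act (embed k ` W')"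
  shows "isomorphic_reps net_act W net_act W'"
proof -
  have "isomorphic_reps net_act (embed k ` W') net_act W'"
    using W' by (intro embed.isomorphic_reps_image_sym) (simp_all add: subrep_def)
  from isomorphic_reps_trans[OF isomorphic_reps_trans[OF embed.isomorphic_reps_image iso] this]
  show ?thesis .
qed

text \<open>All models are placed in the single coordinate \<open>k\<close>. Index sets and types
  stay the same, and only the multiplicities gain the factor \<open>CARD('d)\<close>.\<close>

lemma network_decomposition_embed:
  fixes W :: "nat \<Rightarrow> (real, 's::{finite, monoid_mult}) phase_space set" and k :: "'d::finite"
  assumes N: "network_decomposition IR IC IH W s"
  shows "network_decomposition IR IC IH (\<lambda>i. embed k ` W i) (\<lambda>i. CARD('d) * s i)"
proof -
  define I where "I = IR \<union> IC \<union> IH"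
  note N = N[unfolded network_decomposition_def Let_def, folded I_def]
  have W: "subrep net_act (W i) UNIV" "indecomposable net_act (W i)" "0 < s i" if "i \<in> I" for i
    using N that by auto
  have sub: "IR \<subseteq> I" "IC \<subseteq> I" "IH \<subseteq> I" by (auto simp: I_def)
  have sum: "iso_direct_sum net_act (UNIV :: (real, 's) phase_space set) I s net_act W"
    using N by blast
  have "subrep net_act (embed k ` W i) UNIV" if "i \<in> I" for i
    by (rule subrep_UNIV[OF embed.subrep_image[OF W(1)[OF that]]])
  moreover have "indecomposable net_act (embed k ` W i)" if "i \<in> I" for i
    by (rule embed.indecomposable_image[OF W(2)[OF that]])
  moreover have "real_type net_act (embed k ` W i)" if "i \<in> IR" for i
  proof -
    have "i \<in> I" and "real_type net_act (W i)" using N that sub by auto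
    then show ?thesis
      unfolding real_type_def by (intro End_mod_radical_iso_embed W(1))
  qed
  moreover have "complex_type net_act (embed k ` W i)" if "i \<in> IC" for i
  proof -
    have "i \<in> I" and "complex_type net_act (W i)" using N that sub by auto
    then show ?thesis
      unfolding complex_type_def by (intro End_mod_radical_iso_embed W(1))
  qed
  moreover have "quaternionic_type net_act (embed k ` W i)" if "i \<in> IH" for i
  proof -
    have "i \<in> I" and "quaternionic_type net_act (W i)" using N that sub by auto
    then show ?thesis
      unfolding quaternionic_type_def by (intro End_mod_radical_iso_embed W(1))
  qed
  moreover have "\<not> isomorphic_reps net_act (embed k ` W i) net_act (embed k ` W j)"
    if "i \<in> I" "j \<in> I" "i \<noteq> j" for i j
    using N that not_isomorphic_reps_embed[OF W(1)] by blast
  moreover have "iso_direct_sum net_act (UNIV :: (real ^ 'd, 's) phase_space set) I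
      (\<lambda>i. CARD('d) * s i) net_act (\<lambda>i. embed k ` W i)"
    by (rule iso_direct_sum_all_coordinates[OF sum W(1,3)])
  ultimately show ?thesis
    unfolding network_decomposition_def Let_def I_def[symmetric] using N by simp
qed

lemma le_CARD_mult: "m \<le> n \<Longrightarrow> m \<le> CARD('d::finite) * n"
  by (metis Suc_leI le_trans mult_le_mono1 nat_mult_1 One_nat_def zero_less_card_finite)

text \<open>The multiplicities \<open>m\<close> of the subspace are kept, so the inequality with
  \<open>l\<close> is literally the old one; the bounds on \<open>m i\<close> only become weaker
  because \<open>CARD('d)\<close> is positive.\<close>

lemma kernel_condition_embed:
  fixes U :: "(real, 's::{finite, monoid_mult}) phase_space set" and k :: "'d::finite"
  assumes "kernel_condition l U"
  shows "kernel_condition l (embed k ` U)"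
proof -
  obtain IR IC IH s m and W :: "nat \<Rightarrow> (real, 's) phase_space set"
    where N: "network_decomposition IR IC IH W s" and m: "\<forall>i \<in> IR \<union> IC \<union> IH. m i \<le> s i"
    and U: "iso_direct_sum net_act U (IR \<union> IC \<union> IH) m net_act W"
    and K: "(\<Sum>i\<in>IR. m i) + 2 * (\<Sum>i\<in>IC. m i) + 4 * (\<Sum>i\<in>IH. m i) \<le> l"
    using assms unfolding kernel_condition_def by blast
  have "iso_direct_sum net_act (embed k ` U) (IR \<union> IC \<union> IH) m net_act (\<lambda>i. embed k ` W i)"
    using N by (intro iso_direct_sum_embed[OF U]) (simp add: network_decomposition_def Let_def)
  moreover have "\<forall>i \<in> IR \<union> IC \<union> IH. m i \<le> CARD('d) * s i"
    using m le_CARD_mult by blast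
  ultimately show ?thesis
    unfolding kernel_condition_def using network_decomposition_embed[OF N] K by blast
qed

lemma center_condition_embed:
  fixes U :: "(real, 's::{finite, monoid_mult}) phase_space set" and k :: "'d::finite"
  assumes "center_condition l U"
  shows "center_condition l (embed k ` U)"
proof -
  obtain IR IC IH s m and W :: "nat \<Rightarrow> (real, 's) phase_space set"
    where N: "network_decomposition IR IC IH W s" and m: "\<forall>i \<in> IR \<union> IC \<union> IH. m i \<le> s i"
    and U: "iso_direct_sum net_act U (IR \<union> IC \<union> IH) m net_act W"
    and C: "(\<Sum>i\<in>IR. nat \<lceil>real (m i) / 2\<rceil>) + (\<Sum>i\<in>IC. m i) + (\<Sum>i\<in>IH. m i) \<le> l"
    using assms unfolding center_condition_def by blast
  have "iso_direct_sum net_act (embed k ` U) (IR \<union> IC \<union> IH) m net_act (\<lambda>i. embed k ` W i)"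
    using N by (intro iso_direct_sum_embed[OF U]) (simp add: network_decomposition_def Let_def)
  moreover have "\<forall>i \<in> IR \<union> IC \<union> IH. m i \<le> CARD('d) * s i"
    using m le_CARD_mult by blast
  ultimately show ?thesis
    unfolding center_condition_def using network_decomposition_embed[OF N] C by blast
qed

section \<open>Extended families and their linearizations\<close>

text \<open>In the network, the response function of cell \<open>\<sigma>\<close> receives the
  states of the cells \<open>\<tau> * \<sigma>\<close>. Its argument at \<open>\<tau> = 1\<close> is
  therefore the state of the cell itself, which is why \<open>fst p $ 1 $ j\<close> yields the
  identity in the coordinates other than \<open>k\<close>.\<close>

definition extend_family ::
  "'d \<Rightarrow> ((real, 's::{finite, monoid_mult}) phase_space \<times> (real ^ ('l::finite)) \<Rightarrow> real) \<Rightarrow>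
   (real ^ 'd::finite, 's) phase_space \<times> (real ^ 'l) \<Rightarrow> real ^ 'd" where
  "extend_family k f p = (\<chi> j. if j = k then f (coordinate k (fst p), snd p) else fst p $ 1 $ j)"

lemma admissible_extend_family:
  "admissible (extend_family k f) (w, x) =
    embed k (admissible f (coordinate k w, x)) + (w - embed k (coordinate k w))"
  by (simp add: admissible_def extend_family_def embed_def coordinate_def vec_eq_iff axis_def)

lemma bifurcation_family_extend_family:
  fixes f :: "(real, 's::{finite, monoid_mult}) phase_space \<times> (real ^ ('l::finite)) \<Rightarrow> real"
    and k :: "'d::finite"
  assumes f: "bifurcation_family f"
  shows "bifurcation_family (extend_family k f)"
  unfolding bifurcation_family_def
proof
  have "Ck_on n UNIV (extend_family k f)" for n
  proof -
    \<comment> \<open>The linear part of the extension; coordinate \<open>k\<close> is left to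
      \<open>f\<close>, composed with linear maps on both sides.\<close>
    let ?L = "\<lambda>p :: (real ^ 'd, 's) phase_space \<times> (real ^ 'l). \<chi> j. if j = k then 0 else fst p $ 1 $ j"
    have fn: "Ck_on n UNIV f"
      using f by (simp add: bifurcation_family_def smooth_on_subspace_def)
    have A: "linear (map_prod (coordinate k) id)"
      by (intro linearI) (auto simp: linear_add[OF linear_coordinate] linear_scale[OF linear_coordinate])
    have B: "linear (axis k :: real \<Rightarrow> real ^ 'd)"
      by (intro linearI) (auto simp: axis_def vec_eq_iff)
    have "Ck_on n UNIV (\<lambda>p. axis k (f (map_prod (coordinate k) id p)))"
      by (rule Ck_on_linear_compose[OF subspace_UNIV subspace_UNIV A _ B fn]) simp
    moreover have "Ck_on n UNIV ?L"
      by (intro Ck_on_linear subspace_UNIV linearI) (auto simp: vec_eq_iff)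
    ultimately have "Ck_on n UNIV (\<lambda>p. axis k (f (map_prod (coordinate k) id p)) + ?L p)"
      by (rule Ck_on_add[OF subspace_UNIV])
    moreover have "extend_family k f = (\<lambda>p. axis k (f (map_prod (coordinate k) id p)) + ?L p)"
      by (auto simp: extend_family_def fun_eq_iff vec_eq_iff axis_def map_prod_def split_beta)
    ultimately show ?thesis by simp
  qed
  then show "smooth_on_subspace UNIV (extend_family k f)"
    by (simp add: smooth_on_subspace_def)
  show "admissible (extend_family k f) (0, 0) = 0"
    using f by (simp add: admissible_extend_family bifurcation_family_def)
qed

text \<open>\<open>admissible_linearization\<close> is a chosen derivative, so differentiability has
  to be established first. The admissible map is a sum over the cells of \<open>f\<close> between a
  linear index shift and a linear inclusion.\<close>

lemma has_derivative_admissible_linearization: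
  fixes f :: "('v::euclidean_space, 's::{finite, monoid_mult}) phase_space \<times> (real ^ ('l::finite)) \<Rightarrow> 'v"
  assumes "bifurcation_family f"
  shows "((\<lambda>v. admissible f (v, 0)) has_derivative admissible_linearization f) (at 0)"
proof -
  have "Ck_on 1 UNIV f"
    using assms by (simp add: bifurcation_family_def smooth_on_subspace_def del: One_nat_def)
  then have "f differentiable_on UNIV" by simp
  then have "f differentiable (at 0)"
    unfolding differentiable_on_def by (rule bspec) simp
  then obtain D where D: "(f has_derivative D) (at 0)"
    by (auto simp: differentiable_def)
  let ?A = "\<lambda>\<sigma> v. (\<chi> \<tau>. v $ (\<tau> * \<sigma>), 0) :: ('v, 's) phase_space \<times> (real ^ 'l)"
  have A: "linear (?A \<sigma>)" for \<sigma>
    by (intro linearI) (auto simp: vec_eq_iff)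
  have B: "linear (axis \<sigma> :: 'v \<Rightarrow> ('v, 's) phase_space)" for \<sigma>
    by (intro linearI) (auto simp: axis_def vec_eq_iff)
  \<comment> \<open>Every index shift fixes the origin, so the one derivative of \<open>f\<close> at
    \<open>0\<close> serves all cells.\<close>
  have "(f has_derivative D) (at (?A \<sigma> 0))" for \<sigma>
    using D by (simp only: linear_0[OF A])
  then have "((\<lambda>v. f (?A \<sigma> v)) has_derivative (\<lambda>v. D (?A \<sigma> v))) (at 0)" for \<sigma>
    by (rule has_derivative_compose[OF linear_has_derivative[OF A]])
  from has_derivative_sum[OF has_derivative_linear_image[OF B this]]
  have "((\<lambda>v. \<Sum>\<sigma>\<in>UNIV. axis \<sigma> (f (?A \<sigma> v))) has_derivative
      (\<lambda>v. \<Sum>\<sigma>\<in>UNIV. axis \<sigma> (D (?A \<sigma> v)))) (at 0)" .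
  moreover have "(\<lambda>v. admissible f (v, 0)) = (\<lambda>v. \<Sum>\<sigma>\<in>UNIV. axis \<sigma> (f (?A \<sigma> v)))"
    by (simp add: admissible_def fun_eq_iff vec_eq_iff axis_def if_distrib cong: if_cong)
  ultimately have "(\<lambda>v. admissible f (v, 0)) differentiable (at 0)"
    by (auto simp: differentiable_def)
  then show ?thesis by (simp add: admissible_linearization_def frechet_derivative_works)
qed

text \<open>In \<open>admissible_extend_family\<close> only linear maps surround
  \<open>admissible f\<close>, so the formula passes to derivatives term by term.\<close>

lemma admissible_linearization_extend_family:
  assumes f: "bifurcation_family f"
  shows "admissible_linearization (extend_family k f) w =
    embed k (admissible_linearization f (coordinate k w)) + (w - embed k (coordinate k w))"
proof -
  let ?L = "admissible_linearization f"
  have D: "((\<lambda>w. admissible f (coordinate k w, 0)) has_derivative (\<lambda>w. ?L (coordinate k w))) (at 0)"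
    by (rule has_derivative_compose[OF linear_has_derivative[OF linear_coordinate]])
      (use has_derivative_admissible_linearization[OF f] in simp)
  have "((\<lambda>w. embed k (admissible f (coordinate k w, 0)) + (w - embed k (coordinate k w)))
      has_derivative (\<lambda>w. embed k (?L (coordinate k w)) + (w - embed k (coordinate k w)))) (at 0)"
    by (rule has_derivative_add[OF has_derivative_linear_image[OF linear_embed D]
          has_derivative_diff[OF has_derivative_ident has_derivative_linear_image[OF linear_embed
            linear_has_derivative[OF linear_coordinate]]]])
  then have "((\<lambda>w. admissible (extend_family k f) (w, 0))
      has_derivative (\<lambda>w. embed k (?L (coordinate k w)) + (w - embed k (coordinate k w)))) (at 0)"
    by (simp add: admissible_extend_family)
  from fun_cong[OF frechet_derivative_at[OF this], of w] show ?thesis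
    by (simp add: admissible_linearization_def)
qed

section \<open>Generalized eigenspaces of a map extended by the identity\<close>

context
  fixes L :: "(real, 's::{finite, monoid_mult}) phase_space \<Rightarrow> (real, 's) phase_space"
    and M :: "(real ^ 'd::finite, 's) phase_space \<Rightarrow> (real ^ 'd, 's) phase_space" and k :: 'd
  assumes M: "\<And>w. M w = embed k (L (coordinate k w)) + (w - embed k (coordinate k w))"
begin

lemma in_range_embed_iff: "w \<in> embed k ` A \<longleftrightarrow> coordinate k w \<in> A \<and> w - embed k (coordinate k w) = 0"
  by force

lemma coordinate_extended_map: "coordinate k (M w) = L (coordinate k w)"
  by (simp add: M linear_add[OF linear_coordinate] linear_diff[OF linear_coordinate])

text \<open>In components with respect to the range of \<open>embed k\<close> and the kernel of
  \<open>coordinate k\<close>, \<open>M\<close> applies \<open>L\<close> to the first and the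
  identity to the second. With \<open>coordinate_extended_map\<close>, this controls all iterates of
  \<open>M\<close>.\<close>

lemma complement_extended_map: "M w - embed k (coordinate k (M w)) = w - embed k (coordinate k w)"
  by (simp add: coordinate_extended_map) (simp add: M)

text \<open>Iterating \<open>M\<close> never changes the complementary component, so a vector killed
  by some power of \<open>M\<close> has none.\<close>

lemma generalized_kernel_embed: "generalized_kernel M = embed k ` generalized_kernel L"
proof -
  have coord: "coordinate k ((M ^^ n) w) = (L ^^ n) (coordinate k w)" for n w
    by (induction n) (simp_all add: coordinate_extended_map)
  have compl: "(M ^^ n) w - embed k (coordinate k ((M ^^ n) w)) = w - embed k (coordinate k w)" for n w
    by (induction n) (simp_all add: complement_extended_map)
  have "(M ^^ n) w = 0 \<longleftrightarrow> (L ^^ n) (coordinate k w) = 0 \<and> w - embed k (coordinate k w) = 0" for n w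
    using coord[of n w] compl[of n w] by (metis coordinate_0 diff_0_right embed_0)
  then show ?thesis
    by (auto simp: generalized_kernel_def in_range_embed_iff set_eq_iff)
qed

text \<open>On the complement, \<open>M\<close> minus \<open>z\<close> is multiplication by
  \<open>1 - z\<close>, which is invertible for \<open>z \<noteq> 1\<close>. A power can therefore
  kill a vector only if its complementary component vanishes.\<close>

lemma complex_generalized_eigenspace_embed:
  assumes z: "z \<noteq> 1"
  shows "complex_generalized_eigenspace M z = map_prod (embed k) (embed k) ` complex_generalized_eigenspace L z"
proof -
  define NM where "NM = (\<lambda>q. map_prod M M q - complex_scale z q)"
  define NL where "NL = (\<lambda>q. map_prod L L q - complex_scale z q)"
  define P :: "(real ^ 'd, 's) phase_space \<times> (real ^ 'd, 's) phase_space \<Rightarrow> (real, 's) phase_space \<times> (real, 's) phase_space"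
    where "P = map_prod (coordinate k) (coordinate k)"
  define J :: "(real, 's) phase_space \<times> (real, 's) phase_space \<Rightarrow> (real ^ 'd, 's) phase_space \<times> (real ^ 'd, 's) phase_space"
    where "J = map_prod (embed k) (embed k)"
  \<comment> \<open>On the complexification, \<open>P\<close> projects to the small phase space,
    \<open>J\<close> includes it, and \<open>Q\<close> extracts the complementary component.\<close>
  define Q where "Q p = p - J (P p)" for p
  have scale: "complex_scale v (complex_scale u p) = complex_scale (v * u) p" for v u and p :: "(real ^ 'd, 's) phase_space \<times> (real ^ 'd, 's) phase_space"
    by (auto simp: complex_scale_def algebra_simps)
  have P0: "P 0 = 0" and J0: "J 0 = 0" and PJ: "P (J p) = p" for p
    by (simp_all add: P_def J_def zero_prod_def prod.map_comp comp_def map_prod_def split_beta)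
  have P_NM: "P (NM p) = NL (P p)" for p
    by (cases p) (simp add: P_def NM_def NL_def complex_scale_def coordinate_extended_map
        linear_add[OF linear_coordinate] linear_diff[OF linear_coordinate] linear_scale[OF linear_coordinate])
  have Q_NM: "Q (NM p) = complex_scale (1 - z) (Q p)" for p
  proof (cases p)
    case (Pair x y)
    have "M w = embed k (coordinate k (M w)) + (w - embed k (coordinate k w))" for w
      using complement_extended_map[of w] by (simp add: algebra_simps)
    then show ?thesis
      by (simp add: Pair Q_def P_def J_def NM_def complex_scale_def
        linear_add[OF linear_coordinate] linear_diff[OF linear_coordinate] linear_scale[OF linear_coordinate]
        linear_add[OF linear_embed] linear_diff[OF linear_embed] linear_scale[OF linear_embed] algebra_simps)
  qed
  have P_pow: "P ((NM ^^ n) p) = (NL ^^ n) (P p)" for n p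
    by (induction n) (simp_all add: P_NM)
  have Q_pow: "Q ((NM ^^ n) p) = complex_scale ((1 - z) ^ n) (Q p)" for n p
    by (induction n) (simp_all add: Q_NM scale, simp add: complex_scale_def)
  have scale_0: "complex_scale u q = 0 \<longleftrightarrow> q = 0" if "u \<noteq> 0" for u and q :: "(real ^ 'd, 's) phase_space \<times> (real ^ 'd, 's) phase_space"
  proof
    assume "complex_scale u q = 0"
    then have "complex_scale (inverse u) (complex_scale u q) = 0" by (simp add: complex_scale_def zero_prod_def)
    then have "complex_scale 1 q = 0" using that by (simp only: scale) simp
    then show "q = 0" by (simp add: complex_scale_def)
  qed (simp add: complex_scale_def zero_prod_def)
  have "(NM ^^ n) p = 0 \<longleftrightarrow> P ((NM ^^ n) p) = 0 \<and> Q ((NM ^^ n) p) = 0" for n p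
    using P0 J0 by (auto simp: Q_def)
  then have pow: "(NM ^^ n) p = 0 \<longleftrightarrow> (NL ^^ n) (P p) = 0 \<and> Q p = 0" for n p
    using z by (simp add: P_pow Q_pow scale_0)
  have "p \<in> J ` A \<longleftrightarrow> P p \<in> A \<and> Q p = 0" for p A
    using PJ by (force simp: Q_def)
  then show ?thesis
    unfolding complex_generalized_eigenspace_def NM_def[symmetric] NL_def[symmetric] J_def[symmetric]
    by (auto simp: set_eq_iff pow)
qed

text \<open>The added eigenvalue \<open>1\<close> lies off the imaginary axis, and real parts and
  spans commute with the linear embedding.\<close>

lemma center_subspace_embed: "center_subspace M = embed k ` center_subspace L"
proof -
  have "Complex 0 \<omega> \<noteq> 1" for \<omega> by (simp add: complex_eq_iff)
  then have "fst ` complex_generalized_eigenspace M (Complex 0 \<omega>) =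
      embed k ` fst ` complex_generalized_eigenspace L (Complex 0 \<omega>)" for \<omega>
    by (simp add: complex_generalized_eigenspace_embed image_image)
  then show ?thesis
    by (simp add: center_subspace_def linear_span_image[OF linear_embed] flip: image_UN)
qed

end

section \<open>Equivalence of the reduced problems and conclusion\<close>

lemma equivalent_reduced_problems_embed:
  fixes U :: "(real, 's::{finite, monoid_mult}) phase_space set" and k :: "'d::finite"
  assumes U: "subrep net_act U UNIV"
  shows "equivalent_reduced_problems TYPE('l::finite) Z net_act U net_act (embed k ` U)"
proof (rule equivalent_reduced_problemsI[OF linear_embed linear_coordinate[of k]])
  show "subspace U" "\<And>\<sigma> u. u \<in> U \<Longrightarrow> net_act \<sigma> u \<in> U"
    using U by (auto simp: subrep_def)
  show "subspace (embed k ` U)" "\<And>\<sigma> u. u \<in> embed k ` U \<Longrightarrow> net_act \<sigma> u \<in> embed k ` U"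
    using embed.subrep_image[OF U, of k] by (auto simp: subrep_def)
qed (auto simp: equivariant_def embed_net_act coordinate_net_act)

text \<open>Invariance of the given subspace is read off from its isomorphism with a representation,
  which spares a separate proof for generalized kernels and for center subspaces.\<close>

lemma subrep_if_isomorphic_to_representation:
  fixes U' :: "('v::real_vector, 's::{finite, monoid_mult}) phase_space set"
  assumes a: "representation a U" and iso: "isomorphic_reps a U net_act U'"
  shows "subrep net_act U' UNIV"
proof -
  obtain \<phi> where \<phi>: "linear_map U U' \<phi>" "equivariant a U net_act \<phi>" "U' = \<phi> ` U"
    using iso by (auto simp: isomorphic_reps_def rep_isomorphism_def bij_betw_def)
  have U: "subspace U" "\<And>\<sigma> x. x \<in> U \<Longrightarrow> a \<sigma> x \<in> U"
    using a by (auto simp: representation_def linear_map_def Pi_iff)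
  have add: "\<phi> x + \<phi> y = \<phi> (x + y)" and scale: "c *\<^sub>R \<phi> x = \<phi> (c *\<^sub>R x)"
    if "x \<in> U" "y \<in> U" for x y c
    using \<phi>(1) that by (auto simp: linear_map_def)
  have "subspace U'"
    unfolding \<phi>(3)
  proof (rule subspaceI)
    have "\<phi> 0 = 0" using scale[of 0 0 0] subspace_0[OF U(1)] by simp
    then show "0 \<in> \<phi> ` U" using subspace_0[OF U(1)] by force
    show "x + y \<in> \<phi> ` U" if "x \<in> \<phi> ` U" "y \<in> \<phi> ` U" for x y
      using that add subspace_add[OF U(1)] by auto
    show "c *\<^sub>R x \<in> \<phi> ` U" if "x \<in> \<phi> ` U" for x c
      using that scale subspace_scale[OF U(1)] by auto
  qed
  moreover have "net_act \<sigma> y \<in> U'" if y: "y \<in> U'" for \<sigma> y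
  proof -
    obtain x where x: "x \<in> U" "y = \<phi> x" using y \<phi>(3) by blast
    then have "net_act \<sigma> y = \<phi> (a \<sigma> x)" using \<phi>(2) by (simp add: equivariant_def)
    then show ?thesis using U(2)[OF x(1)] \<phi>(3) by blast
  qed
  ultimately show ?thesis by (simp add: subrep_def)
qed

theorem theorem3p6:
  fixes a :: "'s::{finite, monoid_mult} \<Rightarrow> 'u::real_vector \<Rightarrow> 'u" and U :: "'u set"
  assumes "representation a U"
  shows
    "(\<forall>U1 :: (real, 's) phase_space set.
        generic_generalized_kernel TYPE('l::finite) U1 \<and> isomorphic_reps a U net_act U1 \<longrightarrow>
        (\<exists>U2 :: (real ^ 'd::finite, 's) phase_space set.
           generic_generalized_kernel TYPE('l) U2 \<and> isomorphic_reps a U net_act U2 \<and>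
           equivalent_reduced_problems TYPE('l) {0} net_act U1 net_act U2)) \<and>
     (\<forall>U1 :: (real, 's) phase_space set.
        generic_center_subspace TYPE('l) U1 \<and> isomorphic_reps a U net_act U1 \<longrightarrow>
        (\<exists>U2 :: (real ^ 'd, 's) phase_space set.
           generic_center_subspace TYPE('l) U2 \<and> isomorphic_reps a U net_act U2 \<and>
           equivalent_reduced_problems TYPE('l) {z. Re z = 0} net_act U1 net_act U2))"
proof -
  \<comment> \<open>Any coordinate will do, and one exists because types are nonempty.\<close>
  obtain k :: 'd where True by blast
  \<comment> \<open>The spectral constraint \<open>Z\<close> stays arbitrary, so that both
    \<open>{0}\<close> and the imaginary axis are covered.\<close>
  have transfer: "isomorphic_reps a U net_act (embed k ` U1) \<and>
      equivalent_reduced_problems TYPE('l) Z net_act U1 net_act (embed k ` U1)"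
    if iso: "isomorphic_reps a U net_act U1" for U1 :: "(real, 's) phase_space set" and Z
    using isomorphic_reps_trans[OF iso embed.isomorphic_reps_image]
      equivalent_reduced_problems_embed[OF subrep_if_isomorphic_to_representation[OF assms iso]]
    by blast
  have kernel: "generic_generalized_kernel TYPE('l) (embed k ` U1)"
    if gen: "generic_generalized_kernel TYPE('l) U1" for U1 :: "(real, 's) phase_space set"
  proof -
    obtain f :: "(real, 's) phase_space \<times> (real ^ 'l) \<Rightarrow> real"
      where f: "bifurcation_family f" "U1 = generalized_kernel (admissible_linearization f)"
      using gen unfolding generic_generalized_kernel_def by blast
    \<comment> \<open>The embedded subspace is itself the generalized kernel of the extended family,
      so it can serve directly as \<open>U2\<close>.\<close>
    have "embed k ` U1 = generalized_kernel (admissible_linearization (extend_family k f))"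
      unfolding f(2)
      by (rule generalized_kernel_embed[OF admissible_linearization_extend_family[OF f(1)], symmetric])
    then show ?thesis
      using gen kernel_condition_embed bifurcation_family_extend_family[OF f(1)]
      unfolding generic_generalized_kernel_def by blast
  qed
  have center: "generic_center_subspace TYPE('l) (embed k ` U1)"
    if gen: "generic_center_subspace TYPE('l) U1" for U1 :: "(real, 's) phase_space set"
  proof -
    obtain f :: "(real, 's) phase_space \<times> (real ^ 'l) \<Rightarrow> real"
      where f: "bifurcation_family f" "U1 = center_subspace (admissible_linearization f)"
      using gen unfolding generic_center_subspace_def by blast
    have "embed k ` U1 = center_subspace (admissible_linearization (extend_family k f))"
      unfolding f(2)
      by (rule center_subspace_embed[OF admissible_linearization_extend_family[OF f(1)], symmetric])
    then show ?thesis
      using gen center_condition_embed bifurcation_family_extend_family[OF f(1)]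
      unfolding generic_center_subspace_def by blast
  qed
  show ?thesis using kernel center transfer by blast
qed

end
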